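(* Let $X$ be a second countable locally compact totally disconnected Abelian group. Let $\xi_1,\xi_2,\xi_3$ be independent identically distributed random variables with values in $X$ and a symmetric distribution $\mu$. Let $\alpha$ be a random variable with a Bernoulli distribution taking the values $0$ and $1$ with probability $\frac12$ each, independent of $(\xi_1,\xi_2,\xi_3)$. Then the following are equivalent: (i) the linear forms $2\xi_1$ and $\xi_1+\xi_2+2\alpha\xi_3$ are identically distributed; (ii) there is a compact Corwin subgroup $K$ of $X$ such that either $\mu=m_K$ or $\mu=m_K*E_x$, where $x\in X$ is an element of order $2$.
   Context: A distribution is symmetric if $\mu(B)=\mu(-B)$ for all Borel $B$. A group $K$ is a Corwin group if $\{2x:x\in K\}=K$. $m_K$ is the Haar probability distribution on the compact subgroup $K$, $E_x$ is the point mass at $x$, and $*$ is convolution. *)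

theory Defs
  imports "HOL-Probability.Probability"
begin

primrec nmul :: "nat \<Rightarrow> 'a::ab_group_add \<Rightarrow> 'a" where
  "nmul 0 x = 0"
| "nmul (Suc n) x = x + nmul n x"

definition topological_ab_group :: "'a::{topological_space, ab_group_add} itself \<Rightarrow> bool" where
  "topological_ab_group _ \<longleftrightarrow>
     continuous_on UNIV (\<lambda>p::'a \<times> 'a. fst p + snd p) \<and> continuous_on UNIV (uminus :: 'a \<Rightarrow> 'a)"

definition totally_disconnected_space :: "'a::topological_space itself \<Rightarrow> bool" where
  "totally_disconnected_space _ \<longleftrightarrow> (\<forall>S::'a set. connected S \<longrightarrow> (\<exists>a. S \<subseteq> {a}))"

definition is_subgroup :: "'a::ab_group_add set \<Rightarrow> bool" where
  "is_subgroup K \<longleftrightarrow> 0 \<in> K \<and> (\<forall>x\<in>K. \<forall>y\<in>K. x + y \<in> K) \<and> (\<forall>x\<in>K. - x \<in> K)"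

definition corwin :: "'a::ab_group_add set \<Rightarrow> bool" where
  "corwin K \<longleftrightarrow> (\<lambda>x. x + x) ` K = K"

definition haar_distribution :: "'a::{topological_space, ab_group_add} set \<Rightarrow> 'a measure \<Rightarrow> bool" where
  "haar_distribution K \<nu> \<longleftrightarrow> prob_space \<nu> \<and> sets \<nu> = sets borel \<and> emeasure \<nu> K = 1 \<and>
     (\<forall>k\<in>K. \<forall>B\<in>sets borel. emeasure \<nu> ((\<lambda>y. k + y) ` B) = emeasure \<nu> B)"

definition conv :: "'a::{topological_space, ab_group_add} measure \<Rightarrow> 'a measure \<Rightarrow> 'a measure" where
  "conv M N = distr (M \<Otimes>\<^sub>M N) borel (\<lambda>(x, y). x + y)"

definition point_mass :: "'a::topological_space \<Rightarrow> 'a measure" where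
  "point_mass x = return borel x"

end

theory Submission
  imports Defs
begin

text \<open>
  Put \<open>\<lambda> = \<mu> * \<mu>\<close> and let \<open>\<nu>\<close> be the law of \<open>2 \<xi>\<^sub>1\<close>; condition (i) reads \<open>2 \<nu> = \<lambda> + \<lambda> * \<nu>\<close>.
  For an open subgroup \<open>G\<close>, \<open>\<lambda>(G)\<close> is the sum of the squared \<open>\<mu>\<close>-masses of the cosets of \<open>G\<close>, so by
  Cauchy--Schwarz \<open>\<lambda>(x + G) \<le> \<lambda>(G)\<close>, with equality only if translation by \<open>x\<close> preserves all coset masses.
  Doubling can only merge cosets, hence \<open>\<lambda>(G) \<le> (\<nu> * \<nu>)(G)\<close>, whereas inserting (i) twice bounds
  \<open>4 (\<nu> * \<nu>)(G)\<close> by \<open>(\<lambda> * \<lambda>)(G) + 3 \<lambda>(G)\<close>.  Thus equality holds in Cauchy--Schwarz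
  for \<open>\<lambda>\<close>-almost every \<open>x\<close>, and, as the open subgroups separate measures, \<open>\<mu>\<close> is invariant under sums of
  two elements of its support.  So \<open>\<mu>\<close> is the Haar distribution of a coset \<open>x + K\<close>, and (i) places
  \<open>supp \<mu> + supp \<mu>\<close> inside \<open>2 supp \<mu>\<close>, which makes \<open>K\<close> a Corwin group and allows \<open>2 x = 0\<close>.
\<close>

section \<open>Borel probability measures and their supports\<close>

abbreviation borel_prob :: "'a::topological_space measure \<Rightarrow> bool" where
  "borel_prob M \<equiv> prob_space M \<and> sets M = sets borel"

lemma borel_prob_space: "borel_prob M \<Longrightarrow> space M = UNIV"
  by (metis sets_eq_imp_space_eq space_borel)

definition support :: "'a::topological_space measure \<Rightarrow> 'a set" where
  "support M = {x. \<forall>U. open U \<longrightarrow> x \<in> U \<longrightarrow> emeasure M U \<noteq> 0}"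

lemma closed_support: "closed (support M)"
proof -
  have "- support M = \<Union>{U. open U \<and> emeasure M U = 0}"
    by (auto simp: support_def)
  then show ?thesis unfolding closed_def by auto
qed

text \<open>The complement of the support is the union of all open null sets; by Lindelof's theorem
  countably many of them already cover it.\<close>

lemma AE_support:
  fixes M :: "'a::second_countable_topology measure"
  assumes "sets M = sets borel"
  shows "AE x in M. x \<in> support M"
proof -
  obtain F where F: "F \<subseteq> {U. open U \<and> emeasure M U = 0}" "countable F"
      "\<Union>F = \<Union>{U. open U \<and> emeasure M U = 0}"
    using Lindelof[of "{U. open U \<and> emeasure M U = 0}"] by auto
  have "(\<Union>U\<in>F. U) \<in> null_sets M"
    using F assms by (intro null_sets_UN') (auto simp: null_sets_def)
  moreover have "- support M = (\<Union>U\<in>F. U)"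
    using F(3) by (auto simp: support_def)
  ultimately show ?thesis
    by (intro AE_I'[of "- support M"]) auto
qed

lemma support_subset_closed:
  assumes "sets M = sets borel" "closed C" "AE x in M. x \<in> C"
  shows "support M \<subseteq> C"
proof (rule ccontr)
  assume "\<not> support M \<subseteq> C"
  then obtain x where x: "x \<in> support M" "x \<in> - C" by auto
  have "emeasure M (- C) = emeasure M {}"
    using assms by (intro emeasure_eq_AE) auto
  then show False using x assms(2) by (auto simp: support_def)
qed

text \<open>For a compact subgroup K this is m_K * E_x, characterised intrinsically by concentration
  on x + K and invariance under K, so that no Haar measure has to be constructed. Translations are
  written as preimages, which fit push-forward measures.\<close>

definition coset_haar :: "'a::{topological_space, ab_group_add} set \<Rightarrow> 'a \<Rightarrow> 'a measure \<Rightarrow> bool" where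
  "coset_haar K x M \<longleftrightarrow> borel_prob M \<and> (AE y in M. y - x \<in> K) \<and>
     (\<forall>k\<in>K. \<forall>B\<in>sets borel. emeasure M {y. y + k \<in> B} = emeasure M B)"

lemma AE_notin_iff: "A \<in> sets M \<Longrightarrow> (AE x in M. x \<notin> A) \<longleftrightarrow> emeasure M A = 0"
  by (simp add: null_sets_def flip: AE_iff_null_sets)

section \<open>Continuity and measurability of the group operations\<close>

context
  fixes T :: "'a::{t2_space, second_countable_topology, ab_group_add} itself"
  assumes tg: "topological_ab_group T"
begin

lemma continuous_on_group_add:
  fixes f g :: "'c::topological_space \<Rightarrow> 'a"
  assumes "continuous_on S f" "continuous_on S g"
  shows "continuous_on S (\<lambda>x. f x + g x)"
proof -
  have "continuous_on S ((\<lambda>p. fst p + snd p) \<circ> (\<lambda>x. (f x, g x)))"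
    using tg unfolding topological_ab_group_def
    by (intro continuous_on_compose continuous_on_Pair assms) (auto intro: continuous_on_subset)
  then show ?thesis by (simp add: o_def)
qed

lemma continuous_on_group_minus:
  fixes f :: "'c::topological_space \<Rightarrow> 'a"
  assumes "continuous_on S f"
  shows "continuous_on S (\<lambda>x. - f x)"
proof -
  have "continuous_on S (uminus \<circ> f)"
    using tg unfolding topological_ab_group_def
    by (intro continuous_on_compose assms) (auto intro: continuous_on_subset)
  then show ?thesis by (simp add: o_def)
qed

lemma continuous_on_group_diff:
  fixes f g :: "'c::topological_space \<Rightarrow> 'a"
  assumes "continuous_on S f" "continuous_on S g"
  shows "continuous_on S (\<lambda>x. f x - g x)"
  using continuous_on_group_add[OF assms(1) continuous_on_group_minus[OF assms(2)]] by simp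

lemmas group_continuous_intros =
  continuous_on_group_add continuous_on_group_minus continuous_on_group_diff continuous_intros

lemma measurable_group_add [measurable (raw)]:
  fixes f g :: "'c \<Rightarrow> 'a"
  assumes "f \<in> borel_measurable N" "g \<in> borel_measurable N"
  shows "(\<lambda>x. f x + g x) \<in> borel_measurable N"
  using assms by (rule borel_measurable_continuous_Pair) (intro group_continuous_intros)

lemma measurable_group_minus [measurable (raw)]:
  fixes f :: "'c \<Rightarrow> 'a"
  assumes "f \<in> borel_measurable N"
  shows "(\<lambda>x. - f x) \<in> borel_measurable N"
proof -
  have "(uminus :: 'a \<Rightarrow> 'a) \<in> borel_measurable borel"
    by (intro borel_measurable_continuous_onI group_continuous_intros)
  then show ?thesis using assms by measurable
qed

lemma measurable_group_diff [measurable (raw)]: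
  fixes f g :: "'c \<Rightarrow> 'a"
  assumes "f \<in> borel_measurable N" "g \<in> borel_measurable N"
  shows "(\<lambda>x. f x - g x) \<in> borel_measurable N"
  using measurable_group_add[OF assms(1) measurable_group_minus[OF assms(2)]] by simp

lemma open_group_vimage:
  fixes f :: "'a \<Rightarrow> 'a"
  assumes "continuous_on UNIV f" "open U"
  shows "open {x. f x \<in> U}"
  using open_vimage[OF assms(2,1)] by (simp add: vimage_def)

subsection \<open>Compact open subgroups\<close>

text \<open>Van Dantzig's theorem. As the component of 0 is {0}, some compact open A with 0 in A
  lies inside U; the elements g such that translation by g and by -g maps A into itself form an open
  and closed subgroup, contained in A because 0 is in A.\<close>

lemma compact_open_subgroup_in_nbhd:
  assumes lc: "locally_compact_space (euclidean :: 'a topology)"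
    and td: "totally_disconnected_space T"
    and U: "open (U :: 'a set)" "0 \<in> U"
  obtains G where "compact G" "open G" "is_subgroup G" "G \<subseteq> U"
proof -
  have haus: "Hausdorff_space (euclidean :: 'a topology)"
    unfolding Hausdorff_space_def by (metis disjnt_def hausdorff open_openin)
  obtain V C where VC: "open V" "compact C" "0 \<in> V" "V \<subseteq> (C :: 'a set)"
    using lc unfolding locally_compact_space_def by (simp flip: open_openin) blast
  have conn: "connected_component_of_set euclidean (0::'a) = {0}"
  proof
    have "connectedin euclidean (connected_component_of_set euclidean (0::'a))"
      by (rule connectedin_connected_component_of)
    then obtain a where "connected_component_of_set euclidean (0::'a) \<subseteq> {a}"
      using td unfolding totally_disconnected_space_def by auto
    moreover have "0 \<in> connected_component_of_set euclidean (0::'a)"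
      by (simp add: connected_component_of_refl)
    ultimately show "connected_component_of_set euclidean (0::'a) \<subseteq> {0}" by blast
  qed (simp add: connected_component_of_refl)
  have comp: "{0::'a} \<in> connected_components_of euclidean"
    unfolding connected_components_of_def using conn by (metis UNIV_I imageI topspace_euclidean)
  \<comment> \<open>In a locally compact Hausdorff space a compact component has arbitrarily small
    clopen neighbourhoods. Intersecting with V keeps A inside the compact set C.\<close>
  obtain A B where AB: "openin euclidean A" "openin euclidean B" "disjnt A B" "A \<union> B = UNIV"
      "{0} \<subseteq> A" "A \<subseteq> U \<inter> V"
    using wilder_locally_compact_component_thm[OF lc haus comp, of "U \<inter> V"] U VC
    by (auto simp flip: open_openin)
  have oA: "open A" "open B" using AB by (simp_all flip: open_openin)
  have "B = - A" using AB by (auto simp: disjnt_def)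
  then have clA: "closed A" using oA by (simp add: closed_def)
  have "A \<inter> C = A" using AB VC by auto
  then have cA: "compact A" using VC clA closed_Int_compact by metis
  define G where "G = {g. \<forall>v\<in>A. g + v \<in> A \<and> - g + v \<in> A}"
  have sub: "is_subgroup G"
    unfolding is_subgroup_def
  proof (intro conjI ballI)
    fix x y assume "x \<in> G" "y \<in> G"
    then have "x + (y + v) \<in> A \<and> - x + (- y + v) \<in> A" if "v \<in> A" for v
      using that by (auto simp: G_def)
    then show "x + y \<in> G" by (simp add: G_def algebra_simps)
  qed (auto simp: G_def add.commute)
  have GA: "G \<subseteq> A" using AB by (force simp: G_def)
  \<comment> \<open>Compactness of A lets the tube lemma produce one neighbourhood of g that
    satisfies the defining condition of G for all v in A at once.\<close>
  have oG: "open G"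
  proof (subst open_subopen, rule ballI)
    fix g assume g: "g \<in> G"
    define W where "W = {p. fst p + snd p \<in> A} \<inter> {p. - fst p + snd p \<in> A}"
    have "open W"
      unfolding W_def using oA(1)
      by (intro open_Int open_vimage[unfolded vimage_def] group_continuous_intros)
    moreover have "{g} \<times> A \<subseteq> W" using g by (auto simp: G_def W_def)
    ultimately obtain X0 where X0: "g \<in> X0" "open X0" "X0 \<times> A \<subseteq> W"
      using Elementary_Topology.tube_lemma[OF cA, of W g] by auto
    have "X0 \<subseteq> G"
    proof
      fix y assume "y \<in> X0"
      then have "(y, v) \<in> W" if "v \<in> A" for v using X0(3) that by auto
      then show "y \<in> G" by (simp add: G_def W_def)
    qed
    then show "\<exists>T. open T \<and> g \<in> T \<and> T \<subseteq> G" using X0 by blast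
  qed
  have clG: "closed G"
  proof -
    have "G = (\<Inter>v\<in>A. {g. g + v \<in> A} \<inter> {g. - g + v \<in> A})" by (auto simp: G_def)
    also have "closed \<dots>"
      using clA by (intro closed_INT ballI closed_Int closed_vimage[unfolded vimage_def] group_continuous_intros)
    finally show ?thesis .
  qed
  have "compact G" using closed_Int_compact[OF clG cA] GA by (simp add: Int_absorb2)
  then show ?thesis using that oG sub GA AB by blast
qed

subsection \<open>Convolutions and coset masses\<close>

lemma borel_prob_conv:
  fixes M N :: "'a measure"
  assumes "borel_prob M" "borel_prob N"
  shows "borel_prob (conv M N)"
proof -
  interpret M: prob_space M using assms by simp
  interpret N: prob_space N using assms by simp
  interpret pair_prob_space M N by unfold_locales
  have [measurable_cong]: "sets M = sets borel" "sets N = sets borel" using assms by auto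
  have "(\<lambda>(x, y). x + y) \<in> borel_measurable (M \<Otimes>\<^sub>M N)" by measurable
  then show ?thesis by (auto simp: conv_def intro: prob_space_distr)
qed

lemma emeasure_conv:
  fixes M N :: "'a measure"
  assumes "borel_prob M" "borel_prob N" "B \<in> sets borel"
  shows emeasure_conv1: "emeasure (conv M N) B = (\<integral>\<^sup>+y. emeasure M {x. x + y \<in> B} \<partial>N)"
    and emeasure_conv2: "emeasure (conv M N) B = (\<integral>\<^sup>+x. emeasure N {y. x + y \<in> B} \<partial>M)"
proof -
  interpret M: prob_space M using assms by simp
  interpret N: prob_space N using assms by simp
  interpret pair_prob_space M N by unfold_locales
  have [measurable_cong]: "sets M = sets borel" "sets N = sets borel" using assms by auto
  note [measurable] = assms(3)
  have sp: "space M = UNIV" "space N = UNIV" using assms borel_prob_space by blast+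
  have m: "(\<lambda>(x, y). x + y) \<in> borel_measurable (M \<Otimes>\<^sub>M N)" by measurable
  have s: "(\<lambda>(x, y). x + y) -` B \<inter> space (M \<Otimes>\<^sub>M N) \<in> sets (M \<Otimes>\<^sub>M N)"
    using measurable_sets[OF m] assms by simp
  have e: "emeasure (conv M N) B = emeasure (M \<Otimes>\<^sub>M N) ((\<lambda>(x, y). x + y) -` B \<inter> space (M \<Otimes>\<^sub>M N))"
    unfolding conv_def using m assms by (simp add: emeasure_distr)
  show "emeasure (conv M N) B = (\<integral>\<^sup>+y. emeasure M {x. x + y \<in> B} \<partial>N)"
    unfolding e emeasure_pair_measure_alt2[OF s] by (simp add: vimage_def space_pair_measure sp)
  show "emeasure (conv M N) B = (\<integral>\<^sup>+x. emeasure N {y. x + y \<in> B} \<partial>M)"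
    unfolding e N.emeasure_pair_measure_alt[OF s] by (simp add: vimage_def space_pair_measure sp)
qed

lemma measurable_emeasure_translate:
  fixes M :: "'a measure"
  assumes "borel_prob M" "B \<in> sets borel"
  shows "(\<lambda>y. emeasure M {x. x + y \<in> B}) \<in> borel_measurable borel"
proof -
  interpret M: prob_space M using assms by simp
  have [measurable_cong]: "sets M = sets borel" using assms by auto
  note [measurable] = assms(2)
  have "{p. snd p + fst p \<in> B} \<in> sets (borel \<Otimes>\<^sub>M M)"
    using measurable_sets[of "\<lambda>p. snd p + fst p" "borel \<Otimes>\<^sub>M M" borel B] assms borel_prob_space[of M]
    by (simp add: space_pair_measure vimage_def)
  from M.measurable_emeasure_Pair[OF this] show ?thesis
    by (simp add: vimage_def)
qed

text \<open>The cosets of an open subgroup are pairwise disjoint open sets, so second countability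
  leaves only countably many; R picks one point from each.\<close>

lemma countable_transversal:
  fixes G :: "'a set"
  assumes G: "is_subgroup G" "open G"
  obtains R where "countable R" "\<And>x. \<exists>!r. r \<in> R \<and> x - r \<in> G"
proof -
  have G0: "0 \<in> G" and Ga: "\<And>x y. x \<in> G \<Longrightarrow> y \<in> G \<Longrightarrow> x + y \<in> G" and Gm: "\<And>x. x \<in> G \<Longrightarrow> - x \<in> G"
    using G by (auto simp: is_subgroup_def)
  have Gs: "y - x \<in> G" if "x - y \<in> G" for x y using Gm[OF that] by simp
  have Gt: "x - z \<in> G" if "x - y \<in> G" "y - z \<in> G" for x y z using Ga[OF that] by simp
  \<comment> \<open>Points of one coset give \<open>SOME\<close> the same predicate, so
    \<open>rep\<close> is constant on cosets.\<close>
  define rep where "rep x = (SOME y. x - y \<in> G)" for x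
  have rep: "x - rep x \<in> G" for x
    unfolding rep_def by (rule someI[of _ x]) (simp add: G0)
  have rep_eq: "rep x = rep y" if "x - y \<in> G" for x y
  proof -
    have "(x - z \<in> G) = (y - z \<in> G)" for z using Gt[OF that] Gt[OF Gs[OF that]] by blast
    then show ?thesis by (simp add: rep_def)
  qed
  let ?F = "(\<lambda>r. {x. x - r \<in> G}) ` range rep"
  have "countable ?F"
  proof (rule countable_disjoint_open_subsets)
    show "open S" if "S \<in> ?F" for S
      using that G(2) by (auto intro!: open_group_vimage group_continuous_intros)
    show "pairwise disjnt ?F"
    proof (rule pairwiseI)
      fix A B assume "A \<in> ?F" "B \<in> ?F" and ne: "A \<noteq> B"
      then obtain r s where A: "A = {x. x - r \<in> G}" and B: "B = {x. x - s \<in> G}" by auto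
      show "disjnt A B"
      proof (rule ccontr)
        assume "\<not> disjnt A B"
        then obtain z where z: "z - r \<in> G" "z - s \<in> G" by (auto simp: disjnt_iff A B)
        have "x - r \<in> G \<longleftrightarrow> x - s \<in> G" for x
          using Gt[OF Gt[OF _ Gs[OF z(1)]] z(2)] Gt[OF Gt[OF _ Gs[OF z(2)]] z(1)] by blast
        then show False using ne by (simp add: A B)
      qed
    qed
  qed
  moreover have "inj_on (\<lambda>r. {x. x - r \<in> G}) (range rep)"
  proof (rule inj_onI)
    fix r s assume rs: "r \<in> range rep" "s \<in> range rep" "{x. x - r \<in> G} = {x. x - s \<in> G}"
    have "r \<in> {x. x - r \<in> G}" using G0 by simp
    then have "r - s \<in> G" unfolding rs(3) by simp
    moreover have "rep (rep x) = rep x" for x by (rule rep_eq) (rule Gs[OF rep])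
    then have "rep r = r" "rep s = s" using rs(1,2) by (metis imageE)+
    ultimately show "r = s" using rep_eq[of r s] by simp
  qed
  ultimately have "countable (range rep)" by (rule countable_image_inj_on)
  moreover have "\<exists>!r. r \<in> range rep \<and> x - r \<in> G" for x
  proof (rule ex1I[of _ "rep x"])
    fix r assume "r \<in> range rep \<and> x - r \<in> G"
    then obtain z where "r = rep z" "x - rep z \<in> G" by auto
    then have "x - z \<in> G" using Gt[OF _ Gs[OF rep[of z]]] by blast
    then show "r = rep x" using rep_eq[of x z] \<open>r = rep z\<close> by simp
  qed (simp add: rep)
  ultimately show ?thesis using that by blast
qed

text \<open>A function constant on cosets is a countable sum of multiples of coset indicators, and
  for nonnegative terms sum and integral may be exchanged. Integrals thereby become series over
  coset masses.\<close>

lemma nn_integral_transversal: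
  fixes M :: "'a measure" and f :: "'a \<Rightarrow> ennreal"
  assumes M: "borel_prob M" and G: "is_subgroup G" "open G"
    and R: "countable R" "\<And>x. \<exists>!r. r \<in> R \<and> x - r \<in> G"
    and f: "\<And>x y. x - y \<in> G \<Longrightarrow> f x = f y"
  shows "(\<integral>\<^sup>+x. f x \<partial>M) = (\<integral>\<^sup>+r. f r * emeasure M {x. x - r \<in> G} \<partial>count_space R)"
proof -
  have [measurable]: "{x. x - r \<in> G} \<in> sets M" for r
    using M G(2) by (auto intro!: borel_open open_group_vimage group_continuous_intros)
  have expand: "f x = (\<integral>\<^sup>+r. f r * indicator {x. x - r \<in> G} x \<partial>count_space R)" for x
  proof -
    obtain r0 where r0: "r0 \<in> R" "x - r0 \<in> G" and u: "\<And>r. r \<in> R \<Longrightarrow> x - r \<in> G \<Longrightarrow> r = r0"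
      using R(2)[of x] by blast
    have "(\<integral>\<^sup>+r. f r * indicator {x. x - r \<in> G} x \<partial>count_space R)
        = (\<integral>\<^sup>+r. f r0 * indicator {r0} r \<partial>count_space R)"
    proof (rule nn_integral_cong)
      fix r assume "r \<in> space (count_space R)"
      then have "x - r \<in> G \<longleftrightarrow> r = r0" using r0 u by (metis space_count_space)
      then show "f r * indicator {x. x - r \<in> G} x = f r0 * indicator {r0} r"
        by (simp add: indicator_def)
    qed
    also have "\<dots> = f r0" using r0 by (simp add: nn_integral_cmult_indicator)
    finally show ?thesis using f[OF r0(2)] by (simp only:)
  qed
  have "(\<integral>\<^sup>+x. f x \<partial>M) = (\<integral>\<^sup>+x. \<integral>\<^sup>+r. f r * indicator {x. x - r \<in> G} x \<partial>count_space R \<partial>M)"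
    by (rule nn_integral_cong) (rule expand)
  also have "\<dots> = (\<integral>\<^sup>+r. \<integral>\<^sup>+x. f r * indicator {x. x - r \<in> G} x \<partial>M \<partial>count_space R)"
    by (rule nn_integral_count_space_nn_integral[OF R(1)]) measurable
  also have "\<dots> = (\<integral>\<^sup>+r. f r * emeasure M {x. x - r \<in> G} \<partial>count_space R)"
    by (intro nn_integral_cong nn_integral_cmult_indicator) simp
  finally show ?thesis .
qed

text \<open>With a(r) the mass of r + G and r running over a transversal, the two integrals are the
  sums of a(r + x) a(r) and of a(r)^2. Twice their difference is the sum of (a(r) - a(r + x))^2,
  which vanishes only if x is a period of a.\<close>

lemma coset_mass_correlation:
  fixes M :: "'a measure" and x :: 'a
  assumes M: "borel_prob M" and G: "is_subgroup G" "open G"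
  defines "h \<equiv> \<lambda>x. emeasure M {u. u - x \<in> G}"
  shows coset_mass_correlation_le: "(\<integral>\<^sup>+v. h (v + x) \<partial>M) \<le> (\<integral>\<^sup>+v. h v \<partial>M)"
    and coset_mass_correlation_eq:
      "(\<integral>\<^sup>+v. h (v + x) \<partial>M) = (\<integral>\<^sup>+v. h v \<partial>M) \<Longrightarrow> h (v + x) = h v"
proof -
  let ?P = "\<integral>\<^sup>+v. h (v + x) \<partial>M" and ?Q = "\<integral>\<^sup>+v. h v \<partial>M"
  interpret M: prob_space M using M by simp
  have Ga: "\<And>x y. x \<in> G \<Longrightarrow> y \<in> G \<Longrightarrow> x + y \<in> G" and Gm: "\<And>x. x \<in> G \<Longrightarrow> - x \<in> G"
    using G by (auto simp: is_subgroup_def)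
  have per: "h y = h z" if "y - z \<in> G" for y z
  proof -
    have "u - y \<in> G \<longleftrightarrow> u - z \<in> G" for u
      using Ga[of "u - y" "y - z"] Ga[of "u - z" "- (y - z)"] Gm[OF that] that by auto
    then show ?thesis by (simp add: h_def)
  qed
  obtain R where R: "countable R" "\<And>x. \<exists>!r. r \<in> R \<and> x - r \<in> G"
    using countable_transversal[OF G] by blast
  \<comment> \<open>A shifted transversal is again a transversal, so the sum of squares does not
    change when r is replaced by r + x.\<close>
  have R': "\<exists>!r. r \<in> (\<lambda>r. r + x) ` R \<and> y - r \<in> G" for y
  proof -
    obtain r0 where r0: "r0 \<in> R" "(y - x) - r0 \<in> G" "\<And>r. r \<in> R \<Longrightarrow> (y - x) - r \<in> G \<Longrightarrow> r = r0"
      using R(2)[of "y - x"] by blast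
    show ?thesis
    proof (intro ex1I[of _ "r0 + x"])
      fix r assume r: "r \<in> (\<lambda>r. r + x) ` R \<and> y - r \<in> G"
      then obtain s where s: "s \<in> R" "r = s + x" by blast
      have "(y - x) - s = y - r" by (simp add: s algebra_simps)
      then have "(y - x) - s \<in> G" using r by (simp only:)
      then show "r = r0 + x" using r0(3)[OF s(1)] s(2) by simp
    qed (use r0(1,2) in \<open>simp add: algebra_simps\<close>)
  qed
  \<comment> \<open>The masses are taken as reals here, since truncated subtraction in
    \<open>ennreal\<close> would spoil the square of a difference.\<close>
  define a where "a v = measure M {u. u - v \<in> G}" for v
  have ha: "h v = ennreal (a v)" and a0: "0 \<le> a v" for v
    by (auto simp: h_def a_def M.emeasure_eq_measure)
  have tr: "(\<integral>\<^sup>+v. f v \<partial>M) = (\<integral>\<^sup>+r. f r * h r \<partial>count_space R)"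
    if "countable R" "\<And>x. \<exists>!r. r \<in> R \<and> x - r \<in> G" "\<And>x y. x - y \<in> G \<Longrightarrow> f x = f y"
    for f R
    unfolding h_def using that by (rule nn_integral_transversal[OF M G])
  have P: "?P = (\<integral>\<^sup>+r. h (r + x) * h r \<partial>count_space R)"
    by (rule tr[OF R]) (rule per, simp)
  have Q: "?Q = (\<integral>\<^sup>+r. h r * h r \<partial>count_space R)"
    by (rule tr[OF R per])
  have "?Q = (\<integral>\<^sup>+r. h r * h r \<partial>count_space ((\<lambda>r. r + x) ` R))"
    by (rule tr[OF _ R' per]) (use R in simp)
  also have "\<dots> = (\<integral>\<^sup>+r. h (r + x) * h (r + x) \<partial>count_space R)"
    by (rule nn_integral_bij_count_space[symmetric]) (simp add: bij_betw_def inj_on_def)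
  finally have Q': "?Q = (\<integral>\<^sup>+r. h (r + x) * h (r + x) \<partial>count_space R)" .
  define D where "D = (\<integral>\<^sup>+r. ennreal ((a r - a (r + x))\<^sup>2) \<partial>count_space R)"
  have pt: "ennreal ((a r - a (r + x))\<^sup>2) + 2 * (h (r + x) * h r) = h r * h r + h (r + x) * h (r + x)" for r
  proof -
    have "ennreal ((a r - a (r + x))\<^sup>2) + 2 * (h (r + x) * h r)
        = ennreal ((a r - a (r + x))\<^sup>2 + 2 * (a (r + x) * a r))"
      using a0 by (simp add: ha ennreal_mult)
    also have "(a r - a (r + x))\<^sup>2 + 2 * (a (r + x) * a r) = a r * a r + a (r + x) * a (r + x)"
      by (simp add: power2_eq_square algebra_simps)
    finally show ?thesis using a0 by (simp add: ha ennreal_mult)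
  qed
  have "D + 2 * ?P = (\<integral>\<^sup>+r. ennreal ((a r - a (r + x))\<^sup>2) + 2 * (h (r + x) * h r) \<partial>count_space R)"
    unfolding D_def P by (simp add: nn_integral_add nn_integral_cmult)
  also have "\<dots> = ?Q + ?Q"
    unfolding pt by (subst nn_integral_add) (auto simp: Q'[symmetric] Q[symmetric])
  finally have DPQ: "D + 2 * ?P = 2 * ?Q" by (simp add: mult_2)
  \<comment> \<open>Finiteness of \<open>?Q\<close> is what permits its cancellation in the equality
    case.\<close>
  have "?Q \<le> (\<integral>\<^sup>+v. 1 \<partial>M)" by (intro nn_integral_mono) (simp add: h_def M.measure_le_1)
  then have fin: "?Q < top" by (simp add: M.emeasure_space_1) (metis ennreal_one_less_top order_le_less_trans)
  have "2 * ?P \<le> 2 * ?Q" unfolding DPQ[symmetric] by simp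
  then show "?P \<le> ?Q" by (simp add: ennreal_mult_le_mult_iff)
  assume "?P = ?Q"
  then have "D + 2 * ?Q = 0 + 2 * ?Q" using DPQ by simp
  then have "D = 0" using fin by (auto simp: ennreal_add_left_cancel add.commute ennreal_mult_eq_top_iff)
  then have aR: "a r = a (r + x)" if "r \<in> R" for r
    using that unfolding D_def by (subst (asm) nn_integral_0_iff_AE) (auto simp: AE_count_space)
  obtain r where r: "r \<in> R" "v - r \<in> G" using R(2)[of v] by blast
  have "h (v + x) = h (r + x)" by (rule per) (use r in simp)
  also have "\<dots> = h r" using aR[OF r(1)] by (simp add: ha)
  also have "\<dots> = h v" by (rule per[symmetric]) (use r in simp)
  finally show "h (v + x) = h v" .
qed

text \<open>Continuity of addition gives neighbourhoods A of s and B of t with A + B inside U. Each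
  slice over y in B has at least the positive mass of A, and B itself has positive mass, so U cannot
  be null.\<close>

lemma support_conv:
  fixes M N :: "'a measure"
  assumes M: "borel_prob M" and N: "borel_prob N"
    and s: "s \<in> support M" and t: "t \<in> support N"
  shows "s + t \<in> support (conv M N)"
  unfolding support_def
proof safe
  fix U assume U: "open U" "s + t \<in> U" and z: "emeasure (conv M N) U = 0"
  have [measurable]: "U \<in> sets borel" using U by simp
  have "open {p :: 'a \<times> 'a. fst p + snd p \<in> U}"
    using U(1) by (intro open_vimage[unfolded vimage_def] group_continuous_intros)
  then obtain A B where AB: "open A" "open B" "s \<in> A" "t \<in> B" "A \<times> B \<subseteq> {p. fst p + snd p \<in> U}"
    using U(2) by (auto elim!: open_prod_elim[of _ "(s, t)"])
  have "(\<integral>\<^sup>+y. emeasure M {x. x + y \<in> U} \<partial>N) = 0"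
    using emeasure_conv1[OF M N] z by simp
  moreover have "(\<lambda>y. emeasure M {x. x + y \<in> U}) \<in> borel_measurable N"
    using measurable_emeasure_translate[OF M] N by (simp cong: measurable_cong_sets)
  ultimately have ae: "AE y in N. emeasure M {x. x + y \<in> U} = 0"
    by (simp add: nn_integral_0_iff_AE)
  have "emeasure M {x. x + y \<in> U} \<noteq> 0" if "y \<in> B" for y
  proof -
    have "{x. x + y \<in> U} \<in> sets M" using M by simp
    moreover have "A \<subseteq> {x. x + y \<in> U}" using AB(5) that by auto
    ultimately have "emeasure M A \<le> emeasure M {x. x + y \<in> U}" by (intro emeasure_mono)
    then show ?thesis using s AB by (auto simp: support_def)
  qed
  then have "AE y in N. y \<notin> B" using ae by (auto elim: AE_mp)
  then have "emeasure N B = emeasure N {}"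
    using N AB by (intro emeasure_eq_AE) auto
  then show False using t AB by (auto simp: support_def)
qed

text \<open>Let L y be the \<open>lam\<close>-mass of G - y, which is largest at y = 0. Two uses of
  the mixture equation show that the \<open>lam\<close>-average of L attains L 0, so L = L 0 almost
  everywhere. The coset s + t + G has positive \<open>lam\<close>-mass and therefore contains a
  point y of equality, which is a period of the coset masses.\<close>

lemma coset_mass_period:
  fixes \<mu> :: "'a measure" and v :: 'a
  assumes \<mu>: "borel_prob \<mu>"
    and symm: "\<And>B. B \<in> sets borel \<Longrightarrow> emeasure \<mu> {x. - x \<in> B} = emeasure \<mu> B"
    and eq: "\<And>B. B \<in> sets borel \<Longrightarrow> 2 * emeasure (distr \<mu> borel (\<lambda>x. x + x)) B
      = emeasure (conv \<mu> \<mu>) B + emeasure (conv (conv \<mu> \<mu>) (distr \<mu> borel (\<lambda>x. x + x))) B"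
    and G: "is_subgroup G" "open G"
    and s: "s \<in> support \<mu>" and t: "t \<in> support \<mu>"
  shows "emeasure \<mu> {u. u - (v + (s + t)) \<in> G} = emeasure \<mu> {u. u - v \<in> G}"
proof -
  define lam where "lam = conv \<mu> \<mu>"
  define nu where "nu = distr \<mu> borel (\<lambda>x. x + x)"
  interpret mu: prob_space \<mu> using \<mu> by simp
  have [measurable_cong]: "sets \<mu> = sets borel" using \<mu> by simp
  have dm: "(\<lambda>x. x + x) \<in> borel_measurable \<mu>" by measurable
  have nu: "borel_prob nu" using dm by (simp add: nu_def mu.prob_space_distr)
  have lam: "borel_prob lam" unfolding lam_def by (rule borel_prob_conv[OF \<mu> \<mu>])
  interpret nu: prob_space nu using nu by simp
  interpret lam: prob_space lam using lam by simp
  have Gb [measurable]: "G \<in> sets borel" using G by simp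
  have Ga: "\<And>x y. x \<in> G \<Longrightarrow> y \<in> G \<Longrightarrow> x + y \<in> G" and Gm: "\<And>x. x \<in> G \<Longrightarrow> - x \<in> G"
    using G by (auto simp: is_subgroup_def)
  have Gm': "- x \<in> G \<longleftrightarrow> x \<in> G" for x using Gm[of x] Gm[of "- x"] by auto
  have tr: "{x. x + y \<in> G} \<in> sets borel" for y :: 'a by measurable
  define h where "h y = emeasure \<mu> {u. u - y \<in> G}" for y
  define L where "L y = emeasure lam {x. x + y \<in> G}" for y
  \<comment> \<open>Symmetry of \<mu> together with -G = G turns the convolution \<open>lam\<close>
    into the correlation of coset masses.\<close>
  have Lh: "L y = (\<integral>\<^sup>+b. h (b + y) \<partial>\<mu>)" for y
  proof -
    have "emeasure \<mu> {a. a + b \<in> {x. x + y \<in> G}} = h (b + y)" for b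
    proof -
      have "emeasure \<mu> {a. a + b \<in> {x. x + y \<in> G}} = emeasure \<mu> {a. a \<in> {x. x + b + y \<in> G}}" by simp
      also have "\<dots> = emeasure \<mu> {a. - a \<in> {x. x + b + y \<in> G}}" by (subst symm) simp_all
      also have "{a. - a \<in> {x. x + b + y \<in> G}} = {u. u - (b + y) \<in> G}"
        by (subst Gm'[symmetric]) (simp add: algebra_simps)
      finally show ?thesis by (simp add: h_def)
    qed
    then show ?thesis
      unfolding L_def lam_def by (subst emeasure_conv1[OF \<mu> \<mu> tr]) simp
  qed
  have L0: "L 0 = emeasure lam G" by (simp add: L_def)
  have Lle: "L y \<le> L 0" for y
    using coset_mass_correlation_le[OF \<mu> G, of y] by (simp add: Lh h_def)
  have Lm: "L \<in> borel_measurable borel"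
    unfolding L_def by (rule measurable_emeasure_translate[OF lam Gb])
  have Lmlam: "L \<in> borel_measurable lam" using Lm lam by (simp cong: measurable_cong_sets)
  \<comment> \<open>The mass of G - y under \<open>conv lam nu\<close> is a
    \<open>nu\<close>-average of values of L, hence at most their maximum L 0.\<close>
  have conv_le: "emeasure (conv lam nu) {x. x + y \<in> G} \<le> L 0" for y
  proof -
    have "emeasure (conv lam nu) {x. x + y \<in> G} = (\<integral>\<^sup>+b. L (b + y) \<partial>nu)"
      by (subst emeasure_conv1[OF lam nu tr]) (simp add: L_def add.assoc)
    also have "\<dots> \<le> (\<integral>\<^sup>+b. L 0 \<partial>nu)" by (intro nn_integral_mono Lle)
    finally show ?thesis by (simp add: nu.emeasure_space_1)
  qed
  \<comment> \<open>This is the mixture equation on the translate G - y, with its second summand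
    replaced by the bound L 0.\<close>
  have nu_le: "2 * emeasure nu {x. x + y \<in> G} \<le> L y + L 0" for y
    using eq[OF tr[of y]] conv_le[of y] by (simp add: lam_def nu_def L_def)
  have nu_le': "2 * emeasure nu {x. y + x \<in> G} \<le> L y + L 0" for y
    using nu_le[of y] by (simp add: add.commute)
  have nutr: "(\<lambda>y. emeasure nu {x. x + y \<in> G}) \<in> borel_measurable borel"
    by (rule measurable_emeasure_translate[OF nu Gb])
  \<comment> \<open>The pointwise bound is integrated first against \<open>lam\<close>, then against
    \<open>nu\<close>. In the second case the integral of L is \<open>conv lam nu\<close> at G,
    which the first case estimates.\<close>
  have "2 * emeasure (conv lam nu) G = (\<integral>\<^sup>+x. 2 * emeasure nu {y. x + y \<in> G} \<partial>lam)"
    using nutr lam by (subst emeasure_conv2[OF lam nu Gb])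
      (simp add: nn_integral_cmult add.commute cong: measurable_cong_sets)
  also have "\<dots> \<le> (\<integral>\<^sup>+x. L x + L 0 \<partial>lam)" by (intro nn_integral_mono nu_le')
  also have "\<dots> = (\<integral>\<^sup>+x. L x \<partial>lam) + L 0"
    using Lmlam by (simp add: nn_integral_add lam.emeasure_space_1)
  finally have i1: "2 * emeasure (conv lam nu) G \<le> (\<integral>\<^sup>+x. L x \<partial>lam) + L 0" .
  have "2 * emeasure (conv nu nu) G = (\<integral>\<^sup>+x. 2 * emeasure nu {y. x + y \<in> G} \<partial>nu)"
    using nutr nu by (subst emeasure_conv2[OF nu nu Gb])
      (simp add: nn_integral_cmult add.commute cong: measurable_cong_sets)
  also have "\<dots> \<le> (\<integral>\<^sup>+x. L x + L 0 \<partial>nu)" by (intro nn_integral_mono nu_le')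
  also have "\<dots> = (\<integral>\<^sup>+x. L x \<partial>nu) + L 0"
    using Lm nu by (simp add: nn_integral_add nu.emeasure_space_1 cong: measurable_cong_sets)
  also have "(\<integral>\<^sup>+x. L x \<partial>nu) = emeasure (conv lam nu) G"
    by (simp add: emeasure_conv1[OF lam nu Gb] L_def)
  finally have i2: "2 * emeasure (conv nu nu) G \<le> emeasure (conv lam nu) G + L 0" .
  \<comment> \<open>If a + b lies in G then so does 2a + 2b, so doubling both variables can only
    increase the mass of G.\<close>
  have i3: "L 0 \<le> emeasure (conv nu nu) G"
  proof -
    have "L 0 = (\<integral>\<^sup>+a. emeasure \<mu> {b. a + b \<in> G} \<partial>\<mu>)"
      unfolding L0 lam_def by (rule emeasure_conv2[OF \<mu> \<mu> Gb])
    also have "\<dots> \<le> (\<integral>\<^sup>+a. emeasure nu {y. (a + a) + y \<in> G} \<partial>\<mu>)"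
    proof (rule nn_integral_mono)
      fix a
      have "emeasure nu {y. (a + a) + y \<in> G} = emeasure \<mu> {b. (a + a) + (b + b) \<in> G}"
        unfolding nu_def using borel_prob_space[OF \<mu>] by (subst emeasure_distr) (simp_all add: vimage_def)
      moreover have "{b. a + b \<in> G} \<subseteq> {b. (a + a) + (b + b) \<in> G}"
      proof clarify
        fix b assume "a + b \<in> G"
        from Ga[OF this this] show "(a + a) + (b + b) \<in> G" by (simp add: algebra_simps)
      qed
      ultimately show "emeasure \<mu> {b. a + b \<in> G} \<le> emeasure nu {y. (a + a) + y \<in> G}"
        by (simp add: emeasure_mono)
    qed
    also have "\<dots> = (\<integral>\<^sup>+x. emeasure nu {y. x + y \<in> G} \<partial>nu)"
      using nutr by (simp add: nu_def nn_integral_distr[OF dm] add.commute)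
    also have "\<dots> = emeasure (conv nu nu) G"
      by (rule emeasure_conv2[OF nu nu Gb, symmetric])
    finally show ?thesis .
  qed
  have L0fin: "L 0 < top" unfolding L0 by (simp add: lam.emeasure_eq_measure)
  have "(\<integral>\<^sup>+x. L x \<partial>lam) \<le> (\<integral>\<^sup>+x. L 0 \<partial>lam)" by (intro nn_integral_mono Lle)
  then have Ile: "(\<integral>\<^sup>+x. L x \<partial>lam) \<le> L 0" by (simp add: lam.emeasure_space_1)
  have Ige: "L 0 \<le> (\<integral>\<^sup>+x. L x \<partial>lam)"
  proof -
    obtain l where l: "L 0 = ennreal l" "0 \<le> l" using L0fin by (cases "L 0") auto
    obtain i where i: "(\<integral>\<^sup>+x. L x \<partial>lam) = ennreal i" "0 \<le> i"
      using Ile L0fin by (cases "\<integral>\<^sup>+x. L x \<partial>lam") (auto simp: top_unique)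
    interpret c1: prob_space "conv lam nu" using borel_prob_conv[OF lam nu] by simp
    interpret c2: prob_space "conv nu nu" using borel_prob_conv[OF nu nu] by simp
    \<comment> \<open>In real numbers the three bounds read 2p \<le> i + l, 2q \<le> p + l and l
      \<le> q, whence 4l \<le> i + 3l.\<close>
    define p where "p = c1.prob G"
    define q where "q = c2.prob G"
    have pq: "0 \<le> p" "0 \<le> q" by (simp_all add: p_def q_def)
    have "ennreal (2 * p) \<le> ennreal (i + l)" "ennreal (2 * q) \<le> ennreal (p + l)" "ennreal l \<le> ennreal q"
      using i1 i2 i3 l i pq by (simp_all add: c1.emeasure_eq_measure c2.emeasure_eq_measure ennreal_mult
          flip: p_def q_def)
    then have "2 * p \<le> i + l" "2 * q \<le> p + l" "l \<le> q"
      using l i pq by (simp_all add: ennreal_le_iff del: ennreal_plus)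
    then show ?thesis using i l by simp
  qed
  have AE: "AE y in lam. L y = L 0"
  proof -
    have "(\<integral>\<^sup>+y. L 0 - L y \<partial>lam) = (\<integral>\<^sup>+y. L 0 \<partial>lam) - (\<integral>\<^sup>+y. L y \<partial>lam)"
      using Lmlam Lle Ile L0fin by (intro nn_integral_diff) (auto simp: top_unique)
    also have "\<dots> = 0" using Ige L0fin by (simp add: lam.emeasure_space_1 diff_eq_0_iff_ennreal)
    finally have "AE y in lam. L 0 - L y = 0"
      using Lmlam by (subst (asm) nn_integral_0_iff_AE) auto
    then show ?thesis
      by (rule AE_mp) (use Lle L0fin in \<open>auto simp: diff_eq_0_iff_ennreal intro!: AE_I2 antisym\<close>)
  qed
  have "s + t \<in> support lam" unfolding lam_def by (rule support_conv[OF \<mu> \<mu> s t])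
  moreover have U: "open {y. y - (s + t) \<in> G}"
    by (intro open_group_vimage group_continuous_intros G)
  ultimately have "emeasure lam {y. y - (s + t) \<in> G} \<noteq> 0"
    using G by (auto simp: support_def is_subgroup_def)
  moreover have "emeasure lam {y. y - (s + t) \<in> G} = emeasure lam {}" if "\<And>y. y - (s + t) \<in> G \<Longrightarrow> L y \<noteq> L 0"
    using AE U lam that by (intro emeasure_eq_AE) (auto elim: AE_mp)
  ultimately obtain y where y: "y - (s + t) \<in> G" "L y = L 0" by auto
  have "h (v + y) = h v"
    using coset_mass_correlation_eq[OF \<mu> G, of y v] y(2) by (simp add: Lh h_def)
  \<comment> \<open>The points y and s + t differ by an element of G, so they move v into the same
    coset.\<close>
  moreover have "{u. u - (v + (s + t)) \<in> G} = {u. u - (v + y) \<in> G}"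
  proof -
    have "u - (v + (s + t)) + - (y - (s + t)) = u - (v + y)"
      and "u - (v + y) + (y - (s + t)) = u - (v + (s + t))" for u
      by (simp_all add: algebra_simps)
    then have "u - (v + (s + t)) \<in> G \<longleftrightarrow> u - (v + y) \<in> G" for u
      using Ga[of "u - (v + (s + t))" "- (y - (s + t))"] Ga[of "u - (v + y)" "y - (s + t)"] y(1) Gm[OF y(1)]
      by metis
    then show ?thesis by simp
  qed
  ultimately show ?thesis by (simp add: h_def)
qed

subsection \<open>Invariance under the sums of support points\<close>

text \<open>The cosets of open subgroups, with the empty set, form an intersection-stable generator
  of the Borel sets, so a probability measure is determined by its coset masses. This is applied to
  M and its translate.\<close>

lemma translation_invariant_if_coset_masses:
  fixes M :: "'a measure" and z :: 'a
  assumes lc: "locally_compact_space (euclidean :: 'a topology)"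
    and td: "totally_disconnected_space T"
    and M: "borel_prob M" and B: "B \<in> sets borel"
    and inv: "\<And>G v. is_subgroup G \<Longrightarrow> open G \<Longrightarrow>
      emeasure M {u. u - (v + z) \<in> G} = emeasure M {u. u - v \<in> G}"
  shows "emeasure M {x. x + z \<in> B} = emeasure M B"
proof -
  interpret prob_space M using M by simp
  have [measurable_cong]: "sets M = sets borel" using M by simp
  have sp: "space M = UNIV" by (rule borel_prob_space[OF M])
  define coset :: "'a set \<Rightarrow> 'a \<Rightarrow> 'a set" where "coset G v = {u. u - v \<in> G}" for G v
  define E where "E = insert {} {coset G v | G v. is_subgroup G \<and> open G}"
  have coset_eq: "coset G v = coset G w" if "is_subgroup G" "w \<in> coset G v" for G v w
  proof -
    have "u - v = (u - w) + (w - v)" "u - w = (u - v) + - (w - v)" for u by simp_all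
    then have "u - v \<in> G \<longleftrightarrow> u - w \<in> G" for u
      using that unfolding is_subgroup_def coset_def by (metis mem_Collect_eq)
    then show ?thesis by (simp add: coset_def)
  qed
  have shift: "(\<lambda>x. x + z) \<in> borel_measurable M" by measurable
  have openE: "open C" if "C \<in> E" for C
    using that by (auto simp: E_def coset_def intro!: open_group_vimage group_continuous_intros)
  have stable: "Int_stable E"
  proof (rule Int_stableI)
    fix A B assume AB: "A \<in> E" "B \<in> E"
    show "A \<inter> B \<in> E"
    proof (cases "A \<inter> B = {}")
      case False
      \<comment> \<open>Two cosets that meet can both be based at a common point w; they then
        intersect in w + (G \<inter> H).\<close>
      then obtain w where w: "w \<in> A" "w \<in> B" by auto
      obtain G v where G: "A = coset G v" "is_subgroup G" "open G" using AB w by (auto simp: E_def)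
      obtain H u where H: "B = coset H u" "is_subgroup H" "open H" using AB w by (auto simp: E_def)
      have "A \<inter> B = coset G w \<inter> coset H w" using coset_eq w G H by auto
      also have "\<dots> = coset (G \<inter> H) w" by (auto simp: coset_def)
      finally have "A \<inter> B = coset (G \<inter> H) w" .
      moreover have "is_subgroup (G \<inter> H)" using G H by (auto simp: is_subgroup_def)
      ultimately show ?thesis using G H by (auto simp: E_def)
    qed (simp add: E_def)
  qed
  have gen: "sets borel = sigma_sets UNIV E"
  proof -
    have "sets (borel :: 'a measure) = sigma_sets UNIV (Collect open)"
      by (simp add: borel_def)
    also have "\<dots> = sigma_sets UNIV E"
    proof (rule sigma_sets_eqI)
      fix U :: "'a set" assume "U \<in> Collect open"
      then have U: "open U" by simp
      have "\<exists>C\<in>E. x \<in> C \<and> C \<subseteq> U" if "x \<in> U" for x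
      proof -
        have "open {y. x + y \<in> U}"
          using U by (intro open_group_vimage group_continuous_intros)
        moreover have "0 \<in> {y. x + y \<in> U}" using that by simp
        ultimately obtain G where G: "compact G" "open G" "is_subgroup G" "G \<subseteq> {y. x + y \<in> U}"
          by (rule compact_open_subgroup_in_nbhd[OF lc td])
        have "coset G x \<subseteq> U"
        proof
          fix u assume "u \<in> coset G x"
          then have "x + (u - x) \<in> U" using G(4) by (auto simp: coset_def)
          then show "u \<in> U" by simp
        qed
        moreover have "x \<in> coset G x" using G by (simp add: coset_def is_subgroup_def)
        ultimately show ?thesis using G by (intro bexI[of _ "coset G x"]) (auto simp: E_def)
      qed
      \<comment> \<open>The cosets inside U cover U; Lindelof's theorem reduces this union to a
        countable one, as the sigma-algebra requires.\<close>
      then have Ueq: "U = \<Union>{C \<in> E. C \<subseteq> U}" by auto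
      obtain F where F: "F \<subseteq> {C \<in> E. C \<subseteq> U}" "countable F" "\<Union>F = \<Union>{C \<in> E. C \<subseteq> U}"
        using Lindelof[of "{C \<in> E. C \<subseteq> U}"] openE by auto
      have "\<Union>F \<in> sigma_sets UNIV E"
        by (rule sigma_sets_UNION[OF F(2)]) (use F(1) in auto)
      then show "U \<in> sigma_sets UNIV E" using F(3) Ueq by simp
    qed (use openE in auto)
    finally show ?thesis .
  qed
  have "M = distr M borel (\<lambda>x. x + z)"
  proof (rule measure_eqI_generator_eq[OF stable, where \<Omega>=UNIV and A="\<lambda>_. UNIV"])
    \<comment> \<open>The whole group is itself an open subgroup, so a constant sequence serves as
      the exhaustion by generator sets that the uniqueness theorem asks for.\<close>
    have "UNIV \<in> {coset G v | G v. is_subgroup G \<and> open G}"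
      by (intro CollectI exI[of _ UNIV]) (simp add: coset_def is_subgroup_def)
    then show "range (\<lambda>_::nat. UNIV) \<subseteq> E" by (auto simp: E_def)
    fix X assume X: "X \<in> E"
    show "emeasure M X = emeasure (distr M borel (\<lambda>x. x + z)) X"
    proof (cases "X = {}")
      case False
      then obtain G v where G: "X = coset G v" "is_subgroup G" "open G" using X by (auto simp: E_def)
      have "emeasure (distr M borel (\<lambda>x. x + z)) X = emeasure M {x. x + z \<in> X}"
        using openE[OF X] shift by (subst emeasure_distr) (auto simp: sp vimage_def)
      also have "{x. x + z \<in> X} = {u. u - (v - z) \<in> G}"
        by (simp add: G coset_def algebra_simps)
      finally show ?thesis using inv[OF G(2,3), of "v - z"] by (simp add: G coset_def)
    qed simp
  qed (use M gen in auto)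
  then have "emeasure M B = emeasure (distr M borel (\<lambda>x. x + z)) B" by simp
  also have "\<dots> = emeasure M {x. x + z \<in> B}"
    using B shift by (subst emeasure_distr) (auto simp: sp vimage_def)
  finally show ?thesis by simp
qed

text \<open>Let K be the group of periods of \<mu> and S its support. From S + S \<subseteq> K, S =
  -S and S + K \<subseteq> S it follows that S is a single coset of K. The mixture equation adds S +
  S \<subseteq> 2S, which yields both a base point x with 2x = 0 and the Corwin property.\<close>

lemma coset_haar_if_mixture_equation:
  fixes \<mu> :: "'a measure"
  assumes lc: "locally_compact_space (euclidean :: 'a topology)"
    and td: "totally_disconnected_space T"
    and \<mu>: "borel_prob \<mu>"
    and symm: "\<And>B. B \<in> sets borel \<Longrightarrow> emeasure \<mu> {x. - x \<in> B} = emeasure \<mu> B"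
    and eq: "\<And>B. B \<in> sets borel \<Longrightarrow> 2 * emeasure (distr \<mu> borel (\<lambda>x. x + x)) B
      = emeasure (conv \<mu> \<mu>) B + emeasure (conv (conv \<mu> \<mu>) (distr \<mu> borel (\<lambda>x. x + x))) B"
  obtains K x where "compact K" "is_subgroup K" "corwin K" "x + x = 0" "coset_haar K x \<mu>"
proof -
  interpret prob_space \<mu> using \<mu> by simp
  have [measurable_cong]: "sets \<mu> = sets borel" using \<mu> by simp
  have sp: "space \<mu> = UNIV" by (rule borel_prob_space[OF \<mu>])
  define S where "S = support \<mu>"
  have clS: "closed S" by (simp add: S_def closed_support)
  have AES: "AE x in \<mu>. x \<in> S" unfolding S_def by (rule AE_support) (use \<mu> in simp)
  define K where "K = {z. \<forall>B\<in>sets borel. emeasure \<mu> {x. x + z \<in> B} = emeasure \<mu> B}"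
  have tr: "{x. x + z \<in> B} \<in> sets borel" if [measurable]: "B \<in> sets borel" for B and z :: 'a
    by measurable
  have KI: "emeasure \<mu> {x. x + z \<in> B} = emeasure \<mu> B" if "z \<in> K" "B \<in> sets borel" for z B
    using that by (simp add: K_def)
  have K_sub: "is_subgroup K"
    unfolding is_subgroup_def
  proof (intro conjI ballI)
    fix x y assume xy: "x \<in> K" "y \<in> K"
    show "x + y \<in> K"
      unfolding K_def
    proof (intro CollectI ballI)
      fix B :: "'a set" assume B: "B \<in> sets borel"
      have "emeasure \<mu> {u. u + x \<in> {u. u + y \<in> B}} = emeasure \<mu> B"
        using KI[OF xy(1) tr[OF B]] KI[OF xy(2) B] by simp
      then show "emeasure \<mu> {u. u + (x + y) \<in> B} = emeasure \<mu> B" by (simp add: add.assoc)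
    qed
  next
    fix x assume x: "x \<in> K"
    show "- x \<in> K"
      unfolding K_def
    proof (intro CollectI ballI)
      fix B :: "'a set" assume B: "B \<in> sets borel"
      show "emeasure \<mu> {u. u + - x \<in> B} = emeasure \<mu> B"
        using KI[OF x tr[OF B, of "- x"]] by simp
    qed
  qed (simp add: K_def)
  then have Ka: "\<And>x y. x \<in> K \<Longrightarrow> y \<in> K \<Longrightarrow> x + y \<in> K"
    by (auto simp: is_subgroup_def)
  have SS: "s + t \<in> K" if "s \<in> S" "t \<in> S" for s t
    unfolding K_def
  proof (intro CollectI ballI)
    fix B :: "'a set" assume B: "B \<in> sets borel"
    show "emeasure \<mu> {x. x + (s + t) \<in> B} = emeasure \<mu> B"
    proof (rule translation_invariant_if_coset_masses[OF lc td \<mu> B])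
      fix G :: "'a set" and v assume G: "is_subgroup G" "open G"
      show "emeasure \<mu> {u. u - (v + (s + t)) \<in> G} = emeasure \<mu> {u. u - v \<in> G}"
        by (rule coset_mass_period[OF \<mu> _ _ G that[unfolded S_def]]; (rule symm eq, assumption))
    qed
  qed
  have Sm: "- s \<in> S" if "s \<in> S" for s
    unfolding S_def support_def
  proof safe
    fix U assume U: "open U" "- s \<in> U" "emeasure \<mu> U = 0"
    have "open {x. - x \<in> U}" by (intro open_group_vimage group_continuous_intros U)
    then have "emeasure \<mu> {x. - x \<in> U} \<noteq> 0" using that U by (auto simp: S_def support_def)
    then show False using symm[of U] U by simp
  qed
  have SK: "s + k \<in> S" if "s \<in> S" "k \<in> K" for s k
    unfolding S_def support_def
  proof safe
    fix U assume U: "open U" "s + k \<in> U" "emeasure \<mu> U = 0"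
    have "open {x. x + k \<in> U}" by (intro open_group_vimage group_continuous_intros U)
    then have "emeasure \<mu> {x. x + k \<in> U} \<noteq> 0" using that U by (auto simp: S_def support_def)
    then show False using KI[of k U] U that by simp
  qed
  obtain a where a: "a \<in> S"
  proof -
    have "\<exists>a. a \<in> S"
    proof (rule ccontr)
      assume "\<nexists>a. a \<in> S"
      then have "AE x in \<mu>. False" using AES by simp
      then show False by simp
    qed
    then show ?thesis using that by blast
  qed
  have S_K: "y - s \<in> K" if "s \<in> S" "y \<in> S" for s y
    using SS[OF that(2) Sm[OF that(1)]] by simp
  \<comment> \<open>Differences of points of S are periods, so all cosets of a compact open subgroup
    that meet S share one positive mass c. Total mass 1 allows only finitely many of them, and S is
    closed in their compact union.\<close>
  have compS: "compact S"
  proof -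
    obtain G :: "'a set" where G: "compact G" "open G" "is_subgroup G"
      by (rule compact_open_subgroup_in_nbhd[OF lc td open_UNIV UNIV_I])
    obtain R where R: "countable R" "\<And>x. \<exists>!r. r \<in> R \<and> x - r \<in> G"
      using countable_transversal[OF G(3,2)] by blast
    have ob [measurable]: "{u. u - r \<in> G} \<in> sets borel" for r
      by (intro borel_open open_group_vimage group_continuous_intros G)
    define c where "c = emeasure \<mu> {u. u - a \<in> G}"
    have "open {u. u - a \<in> G}"
      by (intro open_group_vimage group_continuous_intros G)
    then have c0: "c \<noteq> 0" using a G(3) by (auto simp: S_def support_def c_def is_subgroup_def)
    define R' where "R' = {r \<in> R. \<exists>s\<in>S. s - r \<in> G}"
    have big: "emeasure \<mu> {u. u - r \<in> G} = c" if r: "r \<in> R'" for r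
    proof -
      obtain s where s: "s \<in> S" "s - r \<in> G" using r by (auto simp: R'_def)
      \<comment> \<open>Translation by the period s - a carries a + G onto r + G, because s lies in
        the latter.\<close>
      have "emeasure \<mu> {u. u + (s - a) \<in> {u. u - r \<in> G}} = emeasure \<mu> {u. u - r \<in> G}"
        by (rule KI[OF S_K[OF a s(1)] ob])
      also have "{u. u + (s - a) \<in> {u. u - r \<in> G}} = {u. u - a \<in> G}"
      proof -
        have "u + (s - a) - r = (u - a) + (s - r)" "u - a = (u + (s - a) - r) + - (s - r)" for u
          by (simp_all add: algebra_simps)
        then have "u + (s - a) - r \<in> G \<longleftrightarrow> u - a \<in> G" for u
          using G(3) s(2) unfolding is_subgroup_def by metis
        then show ?thesis by simp
      qed
      finally show ?thesis by (simp add: c_def)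
    qed
    have "finite R'"
    proof (rule ccontr)
      assume inf: "infinite R'"
      have "(\<integral>\<^sup>+r. c * indicator R' r \<partial>count_space R) \<le> (\<integral>\<^sup>+r. 1 * emeasure \<mu> {u. u - r \<in> G} \<partial>count_space R)"
        by (intro nn_integral_mono) (auto simp: indicator_def big)
      also have "\<dots> = (\<integral>\<^sup>+x. 1 \<partial>\<mu>)"
        by (rule nn_integral_transversal[OF \<mu> G(3,2) R, symmetric]) simp
      also have "\<dots> = 1" by (simp add: emeasure_space_1)
      also have "(\<integral>\<^sup>+r. c * indicator R' r \<partial>count_space R) = c * emeasure (count_space R) R'"
        by (rule nn_integral_cmult_indicator) (auto simp: R'_def)
      also have "\<dots> = top"
        using inf c0 by (subst emeasure_count_space_infinite) (auto simp: R'_def ennreal_mult_top)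
      finally show False by (simp add: top_unique)
    qed
    moreover have "compact {u. u - r \<in> G}" for r
    proof -
      have "compact ((\<lambda>g. g + r) ` G)"
        by (intro compact_continuous_image group_continuous_intros G)
      moreover have "(\<lambda>g. g + r) ` G = {u. u - r \<in> G}" by (force simp: image_iff)
      ultimately show ?thesis by simp
    qed
    ultimately have "compact (\<Union>r\<in>R'. {u. u - r \<in> G})" by (intro compact_UN) auto
    moreover have "S \<subseteq> (\<Union>r\<in>R'. {u. u - r \<in> G})"
    proof
      fix s assume "s \<in> S"
      moreover obtain r where "r \<in> R" "s - r \<in> G" using R(2)[of s] by blast
      ultimately show "s \<in> (\<Union>r\<in>R'. {u. u - r \<in> G})" by (auto simp: R'_def)
    qed
    ultimately show ?thesis using clS by (metis closed_Int_compact inf.absorb1)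
  qed
  have dm: "(\<lambda>x. x + x) \<in> borel_measurable \<mu>" by measurable
  define D where "D = (\<lambda>x. x + x) ` S"
  have "compact D" unfolding D_def by (intro compact_continuous_image group_continuous_intros compS)
  then have clD: "closed D" by (rule compact_imp_closed)
  have cc: "borel_prob (conv \<mu> \<mu>)" by (rule borel_prob_conv[OF \<mu> \<mu>])
  \<comment> \<open>The doubled law is carried by D = 2S, so the left side of the mixture equation
    vanishes off D. Both nonnegative summands on the right vanish there too, and D is
    closed.\<close>
  have suppD: "support (conv \<mu> \<mu>) \<subseteq> D"
  proof (rule support_subset_closed[OF _ clD])
    have cD: "- D \<in> sets borel" using clD by simp
    have "emeasure (distr \<mu> borel (\<lambda>x. x + x)) (- D) = emeasure \<mu> {x. x + x \<notin> D}"
      using cD dm by (subst emeasure_distr) (auto simp: sp vimage_def)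
    also have "\<dots> = emeasure \<mu> {}"
    proof (rule emeasure_eq_AE)
      show "AE x in \<mu>. x \<in> {x. x + x \<notin> D} \<longleftrightarrow> x \<in> {}"
        using AES by (rule AE_mp) (auto simp: D_def)
      have "{x. x + x \<in> - D} \<in> sets \<mu>" using measurable_sets[OF dm cD] by (simp add: sp vimage_def)
      then show "{x. x + x \<notin> D} \<in> sets \<mu>" by simp
    qed simp
    finally have "emeasure (conv \<mu> \<mu>) (- D) = 0" using eq[OF cD] by simp
    then show "AE x in conv \<mu> \<mu>. x \<in> D"
      using cD cc by (intro AE_I'[of "- D"]) (auto simp: null_sets_def)
  qed (use cc in simp)
  have SSD: "s + t \<in> D" if "s \<in> S" "t \<in> S" for s t
    using suppD support_conv[OF \<mu> \<mu>] that by (auto simp: S_def)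
  \<comment> \<open>Since 0 is a sum of two support points, it is the double of a support point x;
    this x becomes the base point of the coset.\<close>
  have "a + - a \<in> D" by (intro SSD a Sm)
  then obtain x where x: "x \<in> S" "x + x = 0" by (auto simp: D_def)
  have SxK: "y \<in> S \<longleftrightarrow> y - x \<in> K" for y
    using S_K[OF x(1), of y] SK[OF x(1), of "y - x"] by auto
  have "compact K"
  proof -
    have "compact ((\<lambda>s. s - x) ` S)" by (intro compact_continuous_image group_continuous_intros compS)
    moreover have "(\<lambda>s. s - x) ` S = K"
    proof
      show "K \<subseteq> (\<lambda>s. s - x) ` S"
      proof
        fix k assume "k \<in> K"
        then have "k + x \<in> S" using SxK by simp
        then show "k \<in> (\<lambda>s. s - x) ` S" by (intro image_eqI[of _ _ "k + x"]) simp_all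
      qed
    qed (use SxK in auto)
    ultimately show ?thesis by simp
  qed
  moreover have "corwin K"
    unfolding corwin_def
  proof
    show "K \<subseteq> (\<lambda>x. x + x) ` K"
    proof
      fix k assume "k \<in> K"
      \<comment> \<open>As 2x = 0, k is the sum of the support points x + k and x, hence k = s + s
        with s in S. Subtracting 2x = 0 replaces s by the element s - x of K.\<close>
      then have "(x + k) + x \<in> D" by (intro SSD SK x)
      moreover have "(x + k) + x = k" using x(2) by (metis add.commute add.left_neutral add.assoc)
      ultimately obtain s where s: "s \<in> S" "k = s + s" by (auto simp: D_def)
      then have "k = (s - x) + (s - x)" using x(2)
        by (metis add_diff_add diff_zero)
      then show "k \<in> (\<lambda>x. x + x) ` K" using S_K[OF x(1) s(1)] by blast
    qed
  qed (use Ka in auto)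
  moreover have "coset_haar K x \<mu>"
    unfolding coset_haar_def using \<mu> AES KI by (simp add: SxK)
  ultimately show ?thesis using that K_sub x(2) by blast
qed

subsection \<open>Haar distributions of cosets\<close>

text \<open>Concentration follows from (x + K) + (y + K) = x + y + K; invariance is inherited from M
  under the integral over N.\<close>

lemma coset_haar_conv:
  fixes M N :: "'a measure"
  assumes K: "is_subgroup K" "closed K"
    and M: "coset_haar K x M" and N: "coset_haar K y N"
  shows "coset_haar K (x + y) (conv M N)"
proof -
  have bM: "borel_prob M" and bN: "borel_prob N" using M N by (auto simp: coset_haar_def)
  have bC: "borel_prob (conv M N)" by (rule borel_prob_conv[OF bM bN])
  interpret M: prob_space M using bM by simp
  interpret C: prob_space "conv M N" using bC by simp
  have [measurable]: "K \<in> sets borel" using K by simp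
  have Ka: "\<And>x y. x \<in> K \<Longrightarrow> y \<in> K \<Longrightarrow> x + y \<in> K" using K by (auto simp: is_subgroup_def)
  define Z where "Z = {z. z - (x + y) \<notin> K}"
  have Zb [measurable]: "Z \<in> sets borel" unfolding Z_def by measurable
  have "emeasure (conv M N) Z = (\<integral>\<^sup>+b. emeasure M {a. a + b \<in> Z} \<partial>N)"
    by (rule emeasure_conv1[OF bM bN Zb])
  also have "\<dots> = (\<integral>\<^sup>+b. 0 \<partial>N)"
  proof (rule nn_integral_cong_AE)
    have "emeasure M {a. a + b \<in> Z} = 0" if b: "b - y \<in> K" for b
    proof -
      have "{a. a + b \<in> Z} \<in> sets borel" by measurable
      moreover have "AE a in M. a \<notin> {a. a + b \<in> Z}"
      proof -
        have "a + b \<notin> Z" if "a - x \<in> K" for a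
          using Ka[OF that b] by (simp add: Z_def algebra_simps)
        then show ?thesis using M by (auto simp: coset_haar_def elim: AE_mp)
      qed
      ultimately show ?thesis using bM AE_notin_iff[of "{a. a + b \<in> Z}" M] by simp
    qed
    then show "AE b in N. emeasure M {a. a + b \<in> Z} = 0"
      using N by (auto simp: coset_haar_def elim: AE_mp)
  qed
  finally have "AE z in conv M N. z \<notin> Z" using bC by (simp add: AE_notin_iff)
  moreover have "emeasure (conv M N) {z. z + k \<in> B} = emeasure (conv M N) B"
    if k: "k \<in> K" and B [measurable]: "B \<in> sets borel" for k B
  proof -
    have tr: "{a. a + b \<in> B} \<in> sets borel" for b by measurable
    have "emeasure (conv M N) {z. z + k \<in> B} = (\<integral>\<^sup>+b. emeasure M {a. a + b \<in> {z. z + k \<in> B}} \<partial>N)"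
      by (rule emeasure_conv1[OF bM bN]) measurable
    also have "\<dots> = (\<integral>\<^sup>+b. emeasure M {a. a + k \<in> {a. a + b \<in> B}} \<partial>N)"
      by (simp add: algebra_simps)
    also have "\<dots> = (\<integral>\<^sup>+b. emeasure M {a. a + b \<in> B} \<partial>N)"
      using M k tr unfolding coset_haar_def by (intro nn_integral_cong) blast
    also have "\<dots> = emeasure (conv M N) B" by (rule emeasure_conv1[OF bM bN B, symmetric])
    finally show ?thesis .
  qed
  ultimately show ?thesis using bC by (simp add: coset_haar_def Z_def)
qed

text \<open>Doubling maps x + K into K because 2x = 0. For invariance under k the Corwin property
  supplies j in K with k = 2j, and then 2y + k = 2(y + j).\<close>

lemma coset_haar_double:
  fixes M :: "'a measure"
  assumes K: "is_subgroup K" "closed K" "corwin K"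
    and x: "x + x = 0" and M: "coset_haar K x M"
  shows "coset_haar K 0 (distr M borel (\<lambda>y. y + y))"
proof -
  have bM: "borel_prob M" using M by (simp add: coset_haar_def)
  interpret M: prob_space M using bM by simp
  have [measurable_cong]: "sets M = sets borel" using bM by simp
  have [measurable]: "K \<in> sets borel" using K by simp
  have sp: "space M = UNIV" by (rule borel_prob_space[OF bM])
  have dm [measurable]: "(\<lambda>y. y + y) \<in> borel_measurable M" by measurable
  have ed: "emeasure (distr M borel (\<lambda>y. y + y)) B = emeasure M {y. y + y \<in> B}" if "B \<in> sets borel" for B
    using that by (subst emeasure_distr) (auto simp: sp vimage_def)
  have "y + y \<in> K" if "y - x \<in> K" for y
  proof -
    have "(y - x) + (y - x) \<in> K" using that K by (auto simp: is_subgroup_def)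
    moreover have "(y - x) + (y - x) = (y + y) - (x + x)" by (simp add: algebra_simps)
    ultimately show ?thesis by (simp add: x)
  qed
  then have "AE y in M. y + y \<in> K" using M by (auto simp: coset_haar_def elim: AE_mp)
  then have "AE y in distr M borel (\<lambda>y. y + y). y - 0 \<in> K"
    by (subst AE_distr_iff) simp_all
  moreover have "emeasure (distr M borel (\<lambda>y. y + y)) {y. y + k \<in> B} = emeasure (distr M borel (\<lambda>y. y + y)) B"
    if k: "k \<in> K" and B [measurable]: "B \<in> sets borel" for k B
  proof -
    obtain j where j: "j \<in> K" "k = j + j" using K(3) k unfolding corwin_def by blast
    have b1: "{y. y + k \<in> B} \<in> sets borel" and b2: "{y. y + y \<in> B} \<in> sets borel" by measurable
    have "emeasure M {y. y + y \<in> {y. y + k \<in> B}} = emeasure M {y. y + j \<in> {y. y + y \<in> B}}"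
      by (simp add: j algebra_simps)
    also have "\<dots> = emeasure M {y. y + y \<in> B}"
      using M j b2 unfolding coset_haar_def by blast
    finally show ?thesis by (simp add: ed[OF b1] ed[OF B])
  qed
  ultimately show ?thesis using M.prob_space_distr[OF dm] by (simp add: coset_haar_def)
qed

lemma coset_haar_translate:
  fixes M :: "'a measure"
  assumes K: "closed K" and M: "coset_haar K x M"
  shows "coset_haar K (x + z) (distr M borel (\<lambda>y. y + z))"
proof -
  have bM: "borel_prob M" using M by (simp add: coset_haar_def)
  interpret M: prob_space M using bM by simp
  have [measurable_cong]: "sets M = sets borel" using bM by simp
  have [measurable]: "K \<in> sets borel" using K by simp
  have sp: "space M = UNIV" by (rule borel_prob_space[OF bM])
  have dm [measurable]: "(\<lambda>y. y + z) \<in> borel_measurable M" by measurable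
  have ed: "emeasure (distr M borel (\<lambda>y. y + z)) B = emeasure M {y. y + z \<in> B}" if "B \<in> sets borel" for B
    using that by (subst emeasure_distr) (auto simp: sp vimage_def)
  have pm: "{y. y - (x + z) \<in> K} \<in> sets borel" by measurable
  have "AE y in distr M borel (\<lambda>y. y + z). y - (x + z) \<in> K"
    using M pm by (subst AE_distr_iff) (simp_all add: coset_haar_def)
  moreover have "emeasure (distr M borel (\<lambda>y. y + z)) {y. y + k \<in> B} = emeasure (distr M borel (\<lambda>y. y + z)) B"
    if k: "k \<in> K" and B [measurable]: "B \<in> sets borel" for k B
  proof -
    have b1: "{y. y + k \<in> B} \<in> sets borel" and b2: "{y. y + z \<in> B} \<in> sets borel" by measurable
    have "emeasure M {y. y + z \<in> {y. y + k \<in> B}} = emeasure M {y. y + k \<in> {y. y + z \<in> B}}"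
      by (simp add: algebra_simps)
    also have "\<dots> = emeasure M {y. y + z \<in> B}"
      using M k b2 unfolding coset_haar_def by blast
    finally show ?thesis by (simp add: ed[OF b1] ed[OF B])
  qed
  ultimately show ?thesis using M.prob_space_distr[OF dm] by (simp add: coset_haar_def)
qed

text \<open>Invariance of M under K and concentration of N on K give \<open>conv M N\<close> = M;
  with the roles exchanged the same convolution equals N. This is uniqueness of the Haar
  distribution.\<close>

lemma coset_haar_zero_unique:
  fixes M N :: "'a measure"
  assumes M: "coset_haar K 0 M" and N: "coset_haar K 0 N"
  shows "M = N"
proof (rule measure_eqI)
  have bM: "borel_prob M" and bN: "borel_prob N" using M N by (auto simp: coset_haar_def)
  interpret M: prob_space M using bM by simp
  interpret N: prob_space N using bN by simp
  show "sets M = sets N" using bM bN by simp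
  fix B assume "B \<in> sets M"
  then have B: "B \<in> sets borel" using bM by simp
  have "emeasure (conv M N) B = (\<integral>\<^sup>+y. emeasure M B \<partial>N)"
    unfolding emeasure_conv1[OF bM bN B] using M N B
    by (intro nn_integral_cong_AE) (auto simp: coset_haar_def elim: AE_mp)
  moreover have "emeasure (conv M N) B = (\<integral>\<^sup>+x. emeasure N B \<partial>M)"
    unfolding emeasure_conv2[OF bM bN B] using M N B
    by (intro nn_integral_cong_AE) (auto simp: coset_haar_def add.commute elim: AE_mp)
  ultimately show "emeasure M B = emeasure N B"
    by (simp add: M.emeasure_space_1 N.emeasure_space_1)
qed

text \<open>The image of B under adding k is its preimage under adding -k. Since K = -K, both forms
  of invariance range over the same translations.\<close>

lemma haar_distribution_iff_coset_haar:
  fixes M :: "'a measure"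
  assumes K: "is_subgroup K" "closed K"
  shows "haar_distribution K M \<longleftrightarrow> coset_haar K 0 M"
proof (cases "borel_prob M")
  case True
  then interpret prob_space M by simp
  have "(AE y in M. y \<in> K) \<longleftrightarrow> emeasure M K = 1"
    using K True by (simp add: emeasure_eq_measure prob_eq_1)
  moreover have im: "(\<lambda>y. k + y) ` B = {y. y + - k \<in> B}" for k and B :: "'a set"
  proof (intro set_eqI iffI)
    fix y assume "y \<in> {y. y + - k \<in> B}"
    then show "y \<in> (\<lambda>y. k + y) ` B" by (intro image_eqI[of _ _ "y - k"]) simp_all
  qed auto
  have neg: "(\<forall>k\<in>K. P (- k)) \<longleftrightarrow> (\<forall>k\<in>K. P k)" for P
    using K(1) unfolding is_subgroup_def by (metis minus_minus)
  have "(\<forall>k\<in>K. \<forall>B\<in>sets borel. emeasure M ((\<lambda>y. k + y) ` B) = emeasure M B)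
      \<longleftrightarrow> (\<forall>k\<in>K. \<forall>B\<in>sets borel. emeasure M {y. y + k \<in> B} = emeasure M B)"
    unfolding im by (rule neg)
  ultimately show ?thesis using True by (simp add: haar_distribution_def coset_haar_def)
qed (auto simp: haar_distribution_def coset_haar_def)

lemma conv_point_mass:
  fixes M :: "'a measure"
  assumes M: "borel_prob M"
  shows "conv M (point_mass x) = distr M borel (\<lambda>y. y + x)"
proof (rule measure_eqI)
  have P: "borel_prob (point_mass x)" by (simp add: point_mass_def prob_space_return)
  show "sets (conv M (point_mass x)) = sets (distr M borel (\<lambda>y. y + x))"
    using borel_prob_conv[OF M P] by simp
  fix B assume "B \<in> sets (conv M (point_mass x))"
  then have B: "B \<in> sets borel" using borel_prob_conv[OF M P] by simp
  have [measurable_cong]: "sets M = sets borel" using M by simp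
  have dm: "(\<lambda>y. y + x) \<in> borel_measurable M" by measurable
  have "emeasure (conv M (point_mass x)) B = (\<integral>\<^sup>+b. emeasure M {y. y + b \<in> B} \<partial>return borel x)"
    unfolding emeasure_conv1[OF M P B] by (simp add: point_mass_def)
  also have "\<dots> = emeasure M {y. y + x \<in> B}"
    by (rule nn_integral_return) (simp_all add: measurable_emeasure_translate[OF M B])
  also have "\<dots> = emeasure (distr M borel (\<lambda>y. y + x)) B"
    using B dm by (subst emeasure_distr) (auto simp: borel_prob_space[OF M] vimage_def)
  finally show "emeasure (conv M (point_mass x)) B = emeasure (distr M borel (\<lambda>y. y + x)) B" .
qed

text \<open>Translation by -x moves the coset back to K, and convolution with
  \<open>point_mass x\<close> undoes this. It connects the intrinsic description with m_K *
  E_x.\<close>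

lemma coset_haar_iff_conv:
  fixes M :: "'a measure"
  assumes K: "is_subgroup K" "closed K"
  shows "coset_haar K x M \<longleftrightarrow> (\<exists>m. haar_distribution K m \<and> M = conv m (point_mass x))"
proof
  assume M: "coset_haar K x M"
  then have bM: "borel_prob M" by (simp add: coset_haar_def)
  let ?m = "distr M borel (\<lambda>y. y + - x)"
  have m: "coset_haar K 0 ?m" using coset_haar_translate[OF K(2) M, of "- x"] by simp
  then have bm: "borel_prob ?m" by (simp add: coset_haar_def)
  have [measurable_cong]: "sets M = sets borel" using bM by simp
  have "(\<lambda>y. y + x) \<in> borel_measurable borel" "(\<lambda>y. y + - x) \<in> borel_measurable M" by measurable
  then have "conv ?m (point_mass x) = distr M borel (\<lambda>y. y)"
    unfolding conv_point_mass[OF bm] by (subst distr_distr) (auto simp: o_def)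
  also have "\<dots> = M" using bM by (intro distr_id2) simp
  finally have "M = conv ?m (point_mass x)" ..
  moreover have "haar_distribution K ?m"
    using m by (simp only: haar_distribution_iff_coset_haar[OF K])
  ultimately show "\<exists>m. haar_distribution K m \<and> M = conv m (point_mass x)" by blast
next
  assume "\<exists>m. haar_distribution K m \<and> M = conv m (point_mass x)"
  then obtain m where m: "coset_haar K 0 m" "M = conv m (point_mass x)"
    unfolding haar_distribution_iff_coset_haar[OF K] by blast
  then have "borel_prob m" by (simp add: coset_haar_def)
  then show "coset_haar K x M"
    using coset_haar_translate[OF K(2) m(1), of x] by (simp add: m(2) conv_point_mass)
qed

text \<open>The convolution square of M (based at x + x = 0), the doubled law and the convolution of
  these two are all the Haar distribution of K. By uniqueness they coincide, and both sides are
  twice the same mass.\<close>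

lemma mixture_equation_if_coset_haar:
  fixes M :: "'a measure"
  assumes K: "is_subgroup K" "closed K" "corwin K"
    and x: "x + x = 0" and M: "coset_haar K x M"
  shows "2 * emeasure (distr M borel (\<lambda>y. y + y)) B
      = emeasure (conv M M) B + emeasure (conv (conv M M) (distr M borel (\<lambda>y. y + y))) B"
proof -
  let ?N = "distr M borel (\<lambda>y. y + y)"
  have N: "coset_haar K 0 ?N" by (rule coset_haar_double[OF K x M])
  have MM: "coset_haar K 0 (conv M M)" using coset_haar_conv[OF K(1,2) M M] by (simp add: x)
  have "conv M M = ?N" by (rule coset_haar_zero_unique[OF MM N])
  moreover have "conv (conv M M) ?N = ?N"
    by (rule coset_haar_zero_unique[OF _ N]) (use coset_haar_conv[OF K(1,2) MM N] in simp)
  ultimately show ?thesis by (simp only: mult_2)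
qed

subsection \<open>The random linear form\<close>

lemma distr_indep_sum:
  fixes X Y :: "'b \<Rightarrow> 'a"
  assumes "prob_space M" and ind: "prob_space.indep_var M borel X borel Y"
  shows "distr M borel (\<lambda>\<omega>. X \<omega> + Y \<omega>) = conv (distr M borel X) (distr M borel Y)"
proof -
  interpret prob_space M by fact
  have [measurable]: "X \<in> borel_measurable M" "Y \<in> borel_measurable M"
    using ind by (simp_all add: indep_var_distribution_eq)
  have "(\<lambda>(x, y). x + y) \<in> borel_measurable (borel \<Otimes>\<^sub>M borel :: ('a \<times> 'a) measure)" by measurable
  then show ?thesis
    unfolding conv_def using ind by (simp add: indep_var_distribution_eq distr_distr o_def)
qed

text \<open>Splitting by the value of \<alpha>, independence gives the laws of \<xi> 1 + \<xi> 2 and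
  of \<xi> 1 + \<xi> 2 + 2 \<xi> 3 weight 1/2 each; the factor 2 clears the halves. Condition (i)
  thereby becomes an equation in \<mu> alone.\<close>

lemma emeasure_random_switch_sum:
  fixes M :: "'b measure" and \<xi> :: "nat \<Rightarrow> 'b \<Rightarrow> 'a" and \<alpha> :: "'b \<Rightarrow> nat" and \<mu> :: "'a measure"
  assumes M: "prob_space M"
    and \<xi>_meas: "\<And>i. i \<in> {1,2,3} \<Longrightarrow> \<xi> i \<in> borel_measurable M"
    and \<xi>_distr: "\<And>i. i \<in> {1,2,3} \<Longrightarrow> distr M borel (\<xi> i) = \<mu>"
    and \<xi>_indep: "prob_space.indep_vars M (\<lambda>_. borel) \<xi> {1,2,3}"
    and \<alpha>_meas: "\<alpha> \<in> measurable M (count_space UNIV)"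
    and \<alpha>0: "measure M {\<omega> \<in> space M. \<alpha> \<omega> = 0} = 1/2"
    and \<alpha>1: "measure M {\<omega> \<in> space M. \<alpha> \<omega> = 1} = 1/2"
    and \<alpha>_indep: "prob_space.indep_set M
        (sigma_sets (space M) {\<alpha> -` A \<inter> space M | A. A \<in> sets (count_space UNIV)})
        (sigma_sets (space M) {(\<lambda>\<omega>. restrict (\<lambda>i. \<xi> i \<omega>) {1,2,3}) -` A \<inter> space M | A.
                                 A \<in> sets (PiM {1,2,3} (\<lambda>_. borel))})"
    and B: "B \<in> sets borel"
  shows "2 * emeasure (distr M borel (\<lambda>\<omega>. \<xi> 1 \<omega> + \<xi> 2 \<omega> + nmul (2 * \<alpha> \<omega>) (\<xi> 3 \<omega>))) B
    = emeasure (conv \<mu> \<mu>) B + emeasure (conv (conv \<mu> \<mu>) (distr \<mu> borel (\<lambda>x. x + x))) B"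
proof -
  interpret prob_space M by fact
  note [measurable] = \<alpha>_meas B
  have [measurable]: "\<xi> 1 \<in> borel_measurable M" "\<xi> 2 \<in> borel_measurable M" "\<xi> 3 \<in> borel_measurable M"
    using \<xi>_meas by auto
  have nm: "(\<lambda>y. nmul n y) \<in> borel_measurable (borel :: 'a measure)" for n
    by (induction n) simp_all
  \<comment> \<open>The multiplier is random but has countably many values, so measurability need
    only be checked for each fixed multiplier.\<close>
  have nm': "(\<lambda>\<omega>. nmul (2 * \<alpha> \<omega>) (\<xi> 3 \<omega>)) \<in> borel_measurable M"
    by (rule measurable_compose_countable[of "\<lambda>n \<omega>. nmul (2 * n) (\<xi> 3 \<omega>)" M borel \<alpha>])
      (auto intro: measurable_compose[OF _ nm])
  have meas: "(\<lambda>\<omega>. \<xi> 1 \<omega> + \<xi> 2 \<omega> + nmul (2 * \<alpha> \<omega>) (\<xi> 3 \<omega>)) \<in> borel_measurable M"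
    using nm' by measurable
  have i12: "indep_var borel (\<xi> 1) borel (\<xi> 2)"
  proof -
    have "indep_var borel ((\<lambda>f. f 1) \<circ> (\<lambda>\<omega>. restrict (\<lambda>i. \<xi> i \<omega>) {1})) borel ((\<lambda>f. f 2) \<circ> (\<lambda>\<omega>. restrict (\<lambda>i. \<xi> i \<omega>) {2}))"
      by (rule indep_var_compose[OF indep_var_restrict[OF \<xi>_indep, of "{1}" "{2}"]]) simp_all
    then show ?thesis by (simp add: o_def)
  qed
  have i123: "indep_var borel (\<lambda>\<omega>. \<xi> 1 \<omega> + \<xi> 2 \<omega>) borel (\<lambda>\<omega>. \<xi> 3 \<omega> + \<xi> 3 \<omega>)"
  proof -
    have "indep_var borel ((\<lambda>f. f 1 + f 2) \<circ> (\<lambda>\<omega>. restrict (\<lambda>i. \<xi> i \<omega>) {1, 2}))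
        borel ((\<lambda>f. f 3 + f 3) \<circ> (\<lambda>\<omega>. restrict (\<lambda>i. \<xi> i \<omega>) {3}))"
      by (rule indep_var_compose[OF indep_var_restrict[OF \<xi>_indep, of "{1, 2}" "{3}"]]) simp_all
    then show ?thesis by (simp add: o_def)
  qed
  have d12: "distr M borel (\<lambda>\<omega>. \<xi> 1 \<omega> + \<xi> 2 \<omega>) = conv \<mu> \<mu>"
    using distr_indep_sum[OF M i12] \<xi>_distr by simp
  have "distr M borel (\<lambda>\<omega>. \<xi> 3 \<omega> + \<xi> 3 \<omega>) = distr (distr M borel (\<xi> 3)) borel (\<lambda>x. x + x)"
    by (subst distr_distr) (simp_all add: o_def)
  then have d33: "distr M borel (\<lambda>\<omega>. \<xi> 3 \<omega> + \<xi> 3 \<omega>) = distr \<mu> borel (\<lambda>x. x + x)"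
    using \<xi>_distr by simp
  have d123: "distr M borel (\<lambda>\<omega>. \<xi> 1 \<omega> + \<xi> 2 \<omega> + (\<xi> 3 \<omega> + \<xi> 3 \<omega>))
      = conv (conv \<mu> \<mu>) (distr \<mu> borel (\<lambda>x. x + x))"
    using distr_indep_sum[OF M i123] by (simp only: d12 d33)
  define E where "E = {\<omega> \<in> space M. \<xi> 1 \<omega> + \<xi> 2 \<omega> + nmul (2 * \<alpha> \<omega>) (\<xi> 3 \<omega>) \<in> B}"
  define E0 where "E0 = {\<omega> \<in> space M. \<xi> 1 \<omega> + \<xi> 2 \<omega> \<in> B}"
  define E1 where "E1 = {\<omega> \<in> space M. \<xi> 1 \<omega> + \<xi> 2 \<omega> + (\<xi> 3 \<omega> + \<xi> 3 \<omega>) \<in> B}"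
  define A where "A c = {\<omega> \<in> space M. \<alpha> \<omega> = c}" for c
  have E_ev: "E \<in> events"
    using measurable_sets[OF meas B] by (simp add: E_def vimage_def Int_def conj_commute)
  have A_ev [measurable]: "A c \<in> events" for c unfolding A_def by measurable
  have E0_ev: "E0 \<in> events" and E1_ev: "E1 \<in> events" unfolding E0_def E1_def by measurable
  \<comment> \<open>Independence of \<alpha> is given relative to the whole triple; writing D
    through a measurable function \<phi> of the triple covers both \<open>E0\<close> and
    \<open>E1\<close>.\<close>
  have indepA: "prob (A c \<inter> D) = prob (A c) * prob D"
    if "\<phi> \<in> borel_measurable (PiM {1,2,3} (\<lambda>_. borel))" "D = {\<omega> \<in> space M. \<phi> (restrict (\<lambda>i. \<xi> i \<omega>) {1,2,3}) \<in> B}"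
    for c D and \<phi> :: "(nat \<Rightarrow> 'a) \<Rightarrow> 'a"
  proof (rule indep_setD[OF \<alpha>_indep])
    show "A c \<in> sigma_sets (space M) {\<alpha> -` A \<inter> space M | A. A \<in> sets (count_space UNIV)}"
      by (rule sigma_sets.Basic) (auto simp: A_def intro!: exI[of _ "{c}"])
    have "\<phi> -` B \<inter> space (PiM {1,2,3} (\<lambda>_. borel)) \<in> sets (PiM {1,2,3} (\<lambda>_. borel))"
      using that(1) B by (rule measurable_sets)
    then show "D \<in> sigma_sets (space M) {(\<lambda>\<omega>. restrict (\<lambda>i. \<xi> i \<omega>) {1,2,3}) -` A \<inter> space M | A.
                                 A \<in> sets (PiM {1,2,3} (\<lambda>_. borel))}"
      by (intro sigma_sets.Basic CollectI exI conjI) (auto simp: that(2) space_PiM)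
  qed
  have "prob (A 0 \<inter> E0) = prob (A 0) * prob E0"
    by (rule indepA[of "\<lambda>f. f 1 + f 2"]) (auto simp: E0_def)
  then have p0: "2 * prob (A 0 \<inter> E0) = prob E0" using \<alpha>0 by (simp add: A_def)
  have "prob (A 1 \<inter> E1) = prob (A 1) * prob E1"
    by (rule indepA[of "\<lambda>f. f 1 + f 2 + (f 3 + f 3)"]) (auto simp: E1_def)
  then have p1: "2 * prob (A 1 \<inter> E1) = prob E1" using \<alpha>1 by (simp add: A_def)
  \<comment> \<open>As a map into the natural numbers, \<alpha> might take further values; the two
    masses add up to 1, so this happens only on a null set.\<close>
  have "prob (A 0 \<union> A 1) = prob (A 0) + prob (A 1)"
    by (intro finite_measure_Union A_ev) (auto simp: A_def)
  also have "\<dots> = 1" using \<alpha>0 \<alpha>1 by (simp add: A_def)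
  finally have ae: "AE \<omega> in M. \<omega> \<in> A 0 \<union> A 1" by (subst (asm) prob_eq_1) auto
  have "prob E = prob ((A 0 \<inter> E0) \<union> (A 1 \<inter> E1))"
  proof (rule measure_eq_AE)
    show "AE \<omega> in M. \<omega> \<in> E \<longleftrightarrow> \<omega> \<in> (A 0 \<inter> E0) \<union> (A 1 \<inter> E1)"
    proof (rule AE_mp[OF ae], rule AE_I2, rule impI)
      fix \<omega> assume "\<omega> \<in> space M" "\<omega> \<in> A 0 \<union> A 1"
      moreover have "nmul (2 * 1) x = x + x" for x :: 'a by (simp add: numeral_2_eq_2)
      ultimately show "\<omega> \<in> E \<longleftrightarrow> \<omega> \<in> (A 0 \<inter> E0) \<union> (A 1 \<inter> E1)"
        by (auto simp: A_def E_def E0_def E1_def)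
    qed
  qed (use E_ev E0_ev E1_ev in auto)
  also have "\<dots> = prob (A 0 \<inter> E0) + prob (A 1 \<inter> E1)"
    using E0_ev E1_ev by (intro finite_measure_Union) (auto simp: A_def)
  finally have "2 * prob E = prob E0 + prob E1" using p0 p1 by simp
  then have "ennreal (2 * prob E) = ennreal (prob E0 + prob E1)" by (simp only:)
  then have "2 * emeasure M E = emeasure M E0 + emeasure M E1"
    by (simp add: emeasure_eq_measure ennreal_mult)
  moreover have ed: "emeasure (distr M borel X) B = emeasure M {\<omega> \<in> space M. X \<omega> \<in> B}"
    if "X \<in> borel_measurable M" for X :: "'b \<Rightarrow> 'a"
    using that B by (simp add: emeasure_distr vimage_def Int_def conj_commute)
  have "emeasure M E = emeasure (distr M borel (\<lambda>\<omega>. \<xi> 1 \<omega> + \<xi> 2 \<omega> + nmul (2 * \<alpha> \<omega>) (\<xi> 3 \<omega>))) B"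
    unfolding E_def by (rule ed[OF meas, symmetric])
  moreover have "emeasure M E0 = emeasure (conv \<mu> \<mu>) B"
    unfolding d12[symmetric] E0_def by (rule ed[symmetric]) measurable
  moreover have "emeasure M E1 = emeasure (conv (conv \<mu> \<mu>) (distr \<mu> borel (\<lambda>x. x + x))) B"
    unfolding d123[symmetric] E1_def by (rule ed[symmetric]) measurable
  ultimately show "2 * emeasure (distr M borel (\<lambda>\<omega>. \<xi> 1 \<omega> + \<xi> 2 \<omega> + nmul (2 * \<alpha> \<omega>) (\<xi> 3 \<omega>))) B
    = emeasure (conv \<mu> \<mu>) B + emeasure (conv (conv \<mu> \<mu>) (distr \<mu> borel (\<lambda>x. x + x))) B"
    by simp
qed

end

section \<open>Identical distribution of the linear forms and Haar distributions of Corwin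
  groups\<close>

theorem theorem3p3:
  fixes M :: "'b measure"
    and \<xi> :: "nat \<Rightarrow> 'b \<Rightarrow> 'a::{t2_space, second_countable_topology, ab_group_add}"
    and \<alpha> :: "'b \<Rightarrow> nat"
    and \<mu> :: "'a measure"
  assumes top_group: "topological_ab_group TYPE('a)"
    and loc_compact: "locally_compact_space (euclidean :: 'a topology)"
    and tot_disc: "totally_disconnected_space TYPE('a)"
    and M: "prob_space M"
    and \<xi>_meas: "\<And>i. i \<in> {1,2,3} \<Longrightarrow> \<xi> i \<in> borel_measurable M"
    and \<xi>_distr: "\<And>i. i \<in> {1,2,3} \<Longrightarrow> distr M borel (\<xi> i) = \<mu>"
    and \<xi>_indep: "prob_space.indep_vars M (\<lambda>_. borel) \<xi> {1,2,3}"
    and symm: "\<And>B. B \<in> sets borel \<Longrightarrow> emeasure \<mu> B = emeasure \<mu> (uminus ` B)"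
    and \<alpha>_meas: "\<alpha> \<in> measurable M (count_space UNIV)"
    and \<alpha>0: "measure M {\<omega> \<in> space M. \<alpha> \<omega> = 0} = 1/2"
    and \<alpha>1: "measure M {\<omega> \<in> space M. \<alpha> \<omega> = 1} = 1/2"
    and \<alpha>_indep: "prob_space.indep_set M
        (sigma_sets (space M) {\<alpha> -` A \<inter> space M | A. A \<in> sets (count_space UNIV)})
        (sigma_sets (space M) {(\<lambda>\<omega>. restrict (\<lambda>i. \<xi> i \<omega>) {1,2,3}) -` A \<inter> space M | A.
                                 A \<in> sets (PiM {1,2,3} (\<lambda>_. borel))})"
  shows "distr M borel (\<lambda>\<omega>. nmul 2 (\<xi> 1 \<omega>))
           = distr M borel (\<lambda>\<omega>. \<xi> 1 \<omega> + \<xi> 2 \<omega> + nmul (2 * \<alpha> \<omega>) (\<xi> 3 \<omega>))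
    \<longleftrightarrow> (\<exists>K. compact K \<and> is_subgroup K \<and> corwin K \<and>
           (haar_distribution K \<mu> \<or>
            (\<exists>x m. x \<noteq> 0 \<and> x + x = 0 \<and> haar_distribution K m \<and> \<mu> = conv m (point_mass x))))"
proof -
  interpret prob_space M by fact
  have m1: "\<xi> 1 \<in> borel_measurable M" using \<xi>_meas by simp
  have d1: "distr M borel (\<xi> 1) = \<mu>" using \<xi>_distr by simp
  then have \<mu>: "borel_prob \<mu>"
    using prob_space_distr[OF m1] sets_distr[of M borel "\<xi> 1"] by (simp only: simp_thms)
  have dbl: "(\<lambda>x. x + x) \<in> borel_measurable (borel :: 'a measure)"
    by (intro borel_measurable_continuous_onI group_continuous_intros[OF top_group])
  let ?\<nu> = "distr \<mu> borel (\<lambda>x. x + x)"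
  have "distr M borel (\<lambda>\<omega>. nmul 2 (\<xi> 1 \<omega>)) = distr (distr M borel (\<xi> 1)) borel (\<lambda>x. x + x)"
    using dbl m1 by (subst distr_distr) (simp_all add: o_def numeral_2_eq_2)
  then have lhs: "distr M borel (\<lambda>\<omega>. nmul 2 (\<xi> 1 \<omega>)) = ?\<nu>" by (simp only: d1)
  let ?R = "distr M borel (\<lambda>\<omega>. \<xi> 1 \<omega> + \<xi> 2 \<omega> + nmul (2 * \<alpha> \<omega>) (\<xi> 3 \<omega>))"
  have rhs: "2 * emeasure ?R B = emeasure (conv \<mu> \<mu>) B + emeasure (conv (conv \<mu> \<mu>) ?\<nu>) B"
    if "B \<in> sets borel" for B
    by (rule emeasure_random_switch_sum[OF top_group M \<xi>_meas \<xi>_distr \<xi>_indep \<alpha>_meas \<alpha>0 \<alpha>1 \<alpha>_indep that])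
  have half: "a = b" if "2 * a = 2 * b" for a b :: ennreal
    using that by (simp add: ennreal_mult_cancel_left)
  have symm': "emeasure \<mu> {x. - x \<in> B} = emeasure \<mu> B" if "B \<in> sets borel" for B
  proof -
    have "uminus ` B = {x. - x \<in> B}"
    proof (intro set_eqI iffI)
      fix x assume "x \<in> {x. - x \<in> B}"
      then show "x \<in> uminus ` B" by (intro image_eqI[of _ _ "- x"]) simp_all
    qed auto
    then show ?thesis using symm[OF that] by simp
  qed
  \<comment> \<open>The two cases of (ii) are merged into one, a coset x + K with 2x = 0, where x =
    0 stands for m_K itself.\<close>
  have "?\<nu> = ?R \<longleftrightarrow> (\<exists>K x. compact K \<and> is_subgroup K \<and> corwin K \<and> x + x = 0 \<and> coset_haar K x \<mu>)"
  proof
    assume "?\<nu> = ?R"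
    then have eq: "2 * emeasure ?\<nu> B = emeasure (conv \<mu> \<mu>) B + emeasure (conv (conv \<mu> \<mu>) ?\<nu>) B"
      if "B \<in> sets borel" for B
      using rhs[OF that] by (simp only:)
    obtain K x where "compact K" "is_subgroup K" "corwin K" "x + x = 0" "coset_haar K x \<mu>"
      by (rule coset_haar_if_mixture_equation[OF top_group loc_compact tot_disc \<mu> symm' eq])
    then show "\<exists>K x. compact K \<and> is_subgroup K \<and> corwin K \<and> x + x = 0 \<and> coset_haar K x \<mu>"
      by blast
  next
    assume "\<exists>K x. compact K \<and> is_subgroup K \<and> corwin K \<and> x + x = 0 \<and> coset_haar K x \<mu>"
    then obtain K x where K: "compact K" "is_subgroup K" "corwin K" "x + x = 0" "coset_haar K x \<mu>"
      by blast
    show "?\<nu> = ?R"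
    proof (rule measure_eqI)
      fix B assume "B \<in> sets ?\<nu>"
      then have B: "B \<in> sets borel" by simp
      show "emeasure ?\<nu> B = emeasure ?R B"
        by (rule half) (simp only: rhs[OF B]
            mixture_equation_if_coset_haar[OF top_group K(2) compact_imp_closed[OF K(1)] K(3,4,5)])
    qed simp
  qed
  also have "\<dots> \<longleftrightarrow> (\<exists>K. compact K \<and> is_subgroup K \<and> corwin K \<and>
      (haar_distribution K \<mu> \<or>
       (\<exists>x m. x \<noteq> 0 \<and> x + x = 0 \<and> haar_distribution K m \<and> \<mu> = conv m (point_mass x))))"
  proof -
    define C where "C K x \<longleftrightarrow> (\<exists>m. haar_distribution K m \<and> \<mu> = conv m (point_mass x))" for K x
    have "(\<exists>x. x + x = 0 \<and> coset_haar K x \<mu>) \<longleftrightarrow>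
        haar_distribution K \<mu> \<or> (\<exists>x. x \<noteq> 0 \<and> x + x = 0 \<and> C K x)"
      if K: "compact K" "is_subgroup K" for K
    proof -
      note clK = compact_imp_closed[OF K(1)]
      have "coset_haar K x \<mu> \<longleftrightarrow> C K x" for x
        unfolding C_def by (rule coset_haar_iff_conv[OF top_group K(2) clK])
      moreover have "haar_distribution K \<mu> \<longleftrightarrow> C K 0"
        unfolding haar_distribution_iff_coset_haar[OF top_group K(2) clK] by fact
      \<comment> \<open>Splitting off x = 0 leaves exactly the elements of order 2.\<close>
      moreover have "(\<exists>x. x + x = 0 \<and> C K x) \<longleftrightarrow> C K 0 \<or> (\<exists>x. x \<noteq> 0 \<and> x + x = 0 \<and> C K x)"
        using add_0[of "0::'a"] by metis
      ultimately show ?thesis by (simp only:)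
    qed
    then show ?thesis
      unfolding ex_simps by (intro iff_exI conj_cong refl) (simp only: C_def)
  qed
  finally show ?thesis by (simp only: lhs)
qed

end
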